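(* Let $P\subset N_{\mathbb R}$ be a rational polyhedron with at least one vertex, and let $\xi_0,\dots,\xi_k\in\mathcal T_+(P)$ with $\xi_0+\dots+\xi_k=(\underline1;\underline1,\underline0)$. Then the following three conditions are equivalent: (i) $\xi_0,\dots,\xi_k\in\mathcal T_{\mathbb Z}(P)$; (ii) for each vertex $w$ of $P$ and each index $i\in\{0,\dots,k\}$: $w(P_{\xi_i})\notin N$ if and only if $w\notin N$ and $s_w(\xi_i)=1$; (iii) the Minkowski decomposition $P_{\xi_0}+\dots+P_{\xi_k}=P$ is lattice friendly, and $\rho(P_{\xi_i})=\xi_i$ for $i=0,\dots,k$.
   Context: $N$ is a free abelian group of finite rank, $M=\mathrm{Hom}(N,\mathbb Z)$, $N_{\mathbb R}=N\otimes\mathbb R$, $M_{\mathbb R}=M\otimes\mathbb R$, with pairing $\langle\cdot,\cdot\rangle$. $P\subset N_{\mathbb R}$ is a rational polyhedron with at least one vertex, $\mathrm{tail}(P)=\{a:a+P\subseteq P\}$, $\mathrm{tail}(P)^\vee\subseteq M_{\mathbb R}$ the dual cone. Let $v^1,\dots,v^m$ be the vertices and $r$ the number of compact edges of $P$; a compact edge $d$ with endpoints $v^i,v^j$ is also regarded, after choosing an orientation, as the vector $v^j-v^i$. **$\mathcal T(P)$.** For each compact 2-face $F$ choose signs $\varepsilon_F(d)\in\{\pm1\}$ ($d\subset F$ an edge) so that the vectors $\varepsilon_F(d)\,d$ form an oriented cycle along $\partial F$. For a half-open compact edge $[v,w)$ let $g\ge1$ be the least integer such that the affine line through $gv$ and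 $gw$ contains a point of $N$; $[v,w)$ is short if $|g[v,w)\cap N|\le g-1$. $\mathcal T(P)\subseteq\mathbb R^r\oplus\mathbb R^m$ is the set of $(t,s)$, $t=(t_d)=(t_{ij})$, $s=(s_i)=(s_{v^i})$, with: $\sum_{d\subset F}\varepsilon_F(d)t_d\,d=0$ for all compact 2-faces $F$; $s_i=0$ if $v^i\in N$; $s_i=s_j$ if $[v^i,v^j]$ is a compact edge with $[v^i,v^j]\cap N=\emptyset$; $s_i=t_{ij}$ if $[v^i,v^j)$ is a short half-open edge. $\mathcal T_+(P)=\mathcal T(P)\cap(\mathbb R^r_{\ge0}\oplus\mathbb R^m_{\ge0})$. $\mathcal T_{\mathbb Z}(P)$ is the set of $(t,s)\in\mathcal T(P)$ with all $s_i\in\mathbb Z$ and $(t_{ij}-s_i)v^i-(t_{ij}-s_j)v^j\in N$ for all compact edges $[v^i,v^j]$. The element $(\underline1;\underline1,\underline0)\in\mathcal T(P)$ has all $t_{ij}=1$, $s_i=0$ for $v^i\in N$ and $s_i=1$ for $v^i\notin N$. For $\xi\in\mathcal T(P)$, $t_d(\xi),s_w(\xi)$ denote its coordinates. **$P_\xi$.** Fix a reference vertex $v_*$ of $P$; it is assumed that $v_*\notin N$ or $v_*=0$ (after a lattice translation of $P$ if necessary), so that $P_{(\underline1;\underline1,\underline0)}=P$. For $\xi\in\mathcal T_+(P)$ and a vertex $v$ choose a path $v_*=u^0,u^1,\dots,u^l=v$ along compact edges and put $\psi(\xi,v)=s_{v_*}(\xi)v_*+\sum_{j=1}^l t_{u^{j-1}u^j}(\xi)(u^j-u^{j-1})$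 (independent of the path), and $P_\xi=\mathrm{conv}\{\psi(\xi,v):v\text{ vertex of }P\}+\mathrm{tail}(P)$. One has $P_\xi+P_{\xi'}=P_{\xi+\xi'}$. **Minkowski summands.** For $c\in\mathrm{tail}(P)^\vee$ and a polyhedron $Q$ with $\mathrm{tail}(Q)=\mathrm{tail}(P)$, $\mathrm{face}(Q,c)=\{a\in Q:\langle a,c\rangle=\min\langle Q,c\rangle\}$. A polyhedron $Q$ with $\mathrm{tail}(Q)=\mathrm{tail}(P)$ is a Minkowski summand of $P$ if $Q+Q'=P$ for some polyhedron $Q'$ with the same tail cone. For a vertex $w$ of $P$ with $\{w\}=\mathrm{face}(P,c)$, $w(Q)$ denotes the corresponding vertex $\mathrm{face}(Q,c)$ of the summand $Q$ (independent of $c$); for $Q=P_\xi$ it is $\psi(\xi,w)$. A Minkowski decomposition $P=P_0+\dots+P_k$ is lattice friendly if all $P_i$ have tail cone $\mathrm{tail}(P)$ and for every $c\in\mathrm{tail}(P)^\vee\cap M$ there is an index $\mu$ such that $\mathrm{face}(P_i,c)$ contains a point of $N$ for all $i\ne\mu$. The Kodaira–Spencer evaluation of a Minkowski summand $Q$ of $P$ is $\rho(Q)=(t(Q),s(Q))\in\mathbb R^r_{\ge0}\oplus\mathbb R^m$, where $t_{ij}(Q)$ is defined by $v^j(Q)-v^i(Q)=t_{ij}(Q)(v^j-v^i)$, and $s_v(Q)=0$ if $v(Q)\in N$, $s_v(Q)=1$ if $v(Q)\notin N$. *)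

theory Defs
  imports "HOL-Analysis.Analysis" "HOL-Library.Function_Algebras"
begin

text \<open>
  A free abelian group of finite rank is given as the integer span \<open>N\<close> of a linearly independent
  subset of a Euclidean space, and \<open>N\<^sub>\<real>\<close> is \<open>span N\<close>. The span need not be the
  whole type, so every rank, including 0, occurs. The inner product identifies \<open>M\<^sub>\<real>\<close>, the
  dual space of \<open>span N\<close>, with \<open>span N\<close> itself; \<open>dual_lattice N\<close> is then \<open>M = Hom(N, \<int>)\<close>.
\<close>

definition is_lattice :: "'a::euclidean_space set \<Rightarrow> bool" where
  "is_lattice N \<longleftrightarrow>
     (\<exists>B. independent B \<and> N = {(\<Sum>b\<in>B. of_int (z b) *\<^sub>R b) | z :: 'a \<Rightarrow> int. True})"

definition dual_lattice :: "'a::euclidean_space set \<Rightarrow> 'a set" where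
  "dual_lattice N = {u \<in> span N. \<forall>x\<in>N. u \<bullet> x \<in> \<int>}"

definition rational_polyhedron :: "'a::euclidean_space set \<Rightarrow> 'a set \<Rightarrow> bool" where
  "rational_polyhedron N P \<longleftrightarrow>
     (\<exists>A. finite A \<and> A \<subseteq> dual_lattice N \<times> \<rat> \<and>
          P = {x \<in> span N. \<forall>(u, b)\<in>A. b \<le> u \<bullet> x})"

definition tail :: "'a::euclidean_space set \<Rightarrow> 'a set" where
  "tail P = {a. (\<lambda>x. a + x) ` P \<subseteq> P}"

definition tail_dual :: "'a::euclidean_space set \<Rightarrow> 'a set \<Rightarrow> 'a set" where
  "tail_dual N P = {c \<in> span N. \<forall>a\<in>tail P. 0 \<le> a \<bullet> c}"

definition min_face :: "'a::euclidean_space set \<Rightarrow> 'a \<Rightarrow> 'a set" where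
  "min_face Q c = {a \<in> Q. \<forall>b\<in>Q. a \<bullet> c \<le> b \<bullet> c}"

definition vertices :: "'a::euclidean_space set \<Rightarrow> 'a set" where
  "vertices P = {v. v extreme_point_of P}"

definition compact_edges :: "'a::euclidean_space set \<Rightarrow> 'a set set" where
  "compact_edges P = {d. d edge_of P \<and> compact d}"

definition compact_2faces :: "'a::euclidean_space set \<Rightarrow> 'a set set" where
  "compact_2faces P = {F. F face_of P \<and> aff_dim F = 2 \<and> compact F}"


subsection \<open>The space \<open>T(P)\<close>\<close>

text \<open>
  An element \<open>(t, s)\<close> of \<open>\<real>\<^sup>r \<oplus> \<real>\<^sup>m\<close> is a pair of real functions on the
  compact edges and on the vertices of \<open>P\<close>, extended by 0. The coordinate \<open>t\<^sub>i\<^sub>j\<close> is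
  \<open>t (closed_segment v\<^sup>i v\<^sup>j)\<close>.
\<close>

type_synonym 'a param = "('a set \<Rightarrow> real) \<times> ('a \<Rightarrow> real)"

definition params :: "'a::euclidean_space set \<Rightarrow> 'a param set" where
  "params P = {(t, s). (\<forall>d. d \<notin> compact_edges P \<longrightarrow> t d = 0) \<and> (\<forall>v. v \<notin> vertices P \<longrightarrow> s v = 0)}"

text \<open>
  A cyclic enumeration \<open>us\<close> of the vertices along the boundary of a polygon \<open>F\<close> amounts to a choice
  of signs: \<open>\<epsilon>\<^sub>F(d) d\<close> is the vector from \<open>us ! j\<close> to its cyclic successor, for
  \<open>d\<close> the edge joining them. The enumeration is unique up to rotation, which does not affect the sum
  below, and reversal, which changes its sign.
\<close>

definition boundary_cycle :: "'a::euclidean_space set \<Rightarrow> 'a list \<Rightarrow> bool" where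
  "boundary_cycle F us \<longleftrightarrow>
     distinct us \<and> set us = vertices F \<and>
     {d. d edge_of F} =
       {closed_segment (us ! j) (us ! (Suc j mod length us)) | j. j < length us}"

definition closes_up :: "('a set \<Rightarrow> real) \<Rightarrow> 'a::euclidean_space set \<Rightarrow> bool" where
  "closes_up t F \<longleftrightarrow>
     (\<exists>us. boundary_cycle F us \<and>
        (\<Sum>j<length us.
           t (closed_segment (us ! j) (us ! (Suc j mod length us))) *\<^sub>R
             (us ! (Suc j mod length us) - us ! j)) = 0)"

definition half_open :: "'a::euclidean_space \<Rightarrow> 'a \<Rightarrow> 'a set" where
  "half_open v w = closed_segment v w - {w}"

definition line_index :: "'a::euclidean_space set \<Rightarrow> 'a \<Rightarrow> 'a \<Rightarrow> nat" where
  "line_index N v w =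
     (LEAST g. 1 \<le> g \<and> affine hull {real g *\<^sub>R v, real g *\<^sub>R w} \<inter> N \<noteq> {})"

definition short :: "'a::euclidean_space set \<Rightarrow> 'a \<Rightarrow> 'a \<Rightarrow> bool" where
  "short N v w \<longleftrightarrow>
     (let g = line_index N v w
      in card ((\<lambda>x. real g *\<^sub>R x) ` half_open v w \<inter> N) \<le> g - 1)"

definition T :: "'a::euclidean_space set \<Rightarrow> 'a set \<Rightarrow> 'a param set" where
  "T N P = {(t, s) \<in> params P.
     (\<forall>F\<in>compact_2faces P. closes_up t F) \<and>
     (\<forall>v\<in>vertices P. v \<in> N \<longrightarrow> s v = 0) \<and>
     (\<forall>v w. closed_segment v w \<in> compact_edges P \<and> closed_segment v w \<inter> N = {} \<longrightarrow> s v = s w) \<and>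
     (\<forall>v w. closed_segment v w \<in> compact_edges P \<and> short N v w \<longrightarrow> s v = t (closed_segment v w))}"

definition T_plus :: "'a::euclidean_space set \<Rightarrow> 'a set \<Rightarrow> 'a param set" where
  "T_plus N P = {(t, s) \<in> T N P. (\<forall>d\<in>compact_edges P. 0 \<le> t d) \<and> (\<forall>v\<in>vertices P. 0 \<le> s v)}"

definition T_int :: "'a::euclidean_space set \<Rightarrow> 'a set \<Rightarrow> 'a param set" where
  "T_int N P = {(t, s) \<in> T N P.
     (\<forall>v\<in>vertices P. s v \<in> \<int>) \<and>
     (\<forall>v w. closed_segment v w \<in> compact_edges P \<longrightarrow>
        (t (closed_segment v w) - s v) *\<^sub>R v - (t (closed_segment v w) - s w) *\<^sub>R w \<in> N)}"

definition one_param :: "'a::euclidean_space set \<Rightarrow> 'a set \<Rightarrow> 'a param" where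
  "one_param N P =
     (\<lambda>d. if d \<in> compact_edges P then 1 else 0, \<lambda>v. if v \<in> vertices P \<and> v \<notin> N then 1 else 0)"


subsection \<open>The polyhedra \<open>P\<^sub>\<xi>\<close>\<close>

definition edge_path :: "'a::euclidean_space set \<Rightarrow> 'a \<Rightarrow> 'a \<Rightarrow> 'a list \<Rightarrow> bool" where
  "edge_path P v w us \<longleftrightarrow>
     us \<noteq> [] \<and> hd us = v \<and> last us = w \<and>
     (\<forall>j. Suc j < length us \<longrightarrow> closed_segment (us ! j) (us ! Suc j) \<in> compact_edges P)"

text \<open>The argument \<open>v0\<close> is the reference vertex.\<close>

definition psi :: "'a::euclidean_space set \<Rightarrow> 'a \<Rightarrow> 'a param \<Rightarrow> 'a \<Rightarrow> 'a" where
  "psi P v0 \<xi> v =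
     (let us = (SOME us. edge_path P v0 v us)
      in snd \<xi> v0 *\<^sub>R v0 +
         (\<Sum>j<length us - 1.
            fst \<xi> (closed_segment (us ! j) (us ! Suc j)) *\<^sub>R (us ! Suc j - us ! j)))"

definition P_param :: "'a::euclidean_space set \<Rightarrow> 'a \<Rightarrow> 'a param \<Rightarrow> 'a set" where
  "P_param P v0 \<xi> = convex hull (psi P v0 \<xi> ` vertices P) + tail P"


subsection \<open>Minkowski summands\<close>

text \<open>The vertex \<open>w(Q)\<close> of a Minkowski summand \<open>Q\<close> of \<open>P\<close>; it does not depend on \<open>c\<close>.\<close>

definition vertex_in :: "'a::euclidean_space set \<Rightarrow> 'a set \<Rightarrow> 'a \<Rightarrow> 'a set \<Rightarrow> 'a" where
  "vertex_in N P w Q = (THE x. \<exists>c\<in>tail_dual N P. min_face P c = {w} \<and> min_face Q c = {x})"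

definition minkowski_decomposition ::
    "'a::euclidean_space set \<Rightarrow> nat \<Rightarrow> (nat \<Rightarrow> 'a set) \<Rightarrow> bool" where
  "minkowski_decomposition P k Q \<longleftrightarrow> (\<forall>i\<le>k. polyhedron (Q i)) \<and> (\<Sum>i\<le>k. Q i) = P"

definition lattice_friendly ::
    "'a::euclidean_space set \<Rightarrow> 'a set \<Rightarrow> nat \<Rightarrow> (nat \<Rightarrow> 'a set) \<Rightarrow> bool" where
  "lattice_friendly N P k Q \<longleftrightarrow>
     minkowski_decomposition P k Q \<and>
     (\<forall>i\<le>k. tail (Q i) = tail P) \<and>
     (\<forall>c \<in> tail_dual N P \<inter> dual_lattice N.
        \<exists>\<mu>\<le>k. \<forall>i\<le>k. i \<noteq> \<mu> \<longrightarrow> min_face (Q i) c \<inter> N \<noteq> {})"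

definition t_coord :: "'a::euclidean_space set \<Rightarrow> 'a set \<Rightarrow> 'a set \<Rightarrow> 'a set \<Rightarrow> real" where
  "t_coord N P Q d =
     (THE \<tau>. \<forall>v w. d = closed_segment v w \<longrightarrow>
        vertex_in N P w Q - vertex_in N P v Q = \<tau> *\<^sub>R (w - v))"

definition kodaira_spencer :: "'a::euclidean_space set \<Rightarrow> 'a set \<Rightarrow> 'a set \<Rightarrow> 'a param" where
  "kodaira_spencer N P Q =
     (\<lambda>d. if d \<in> compact_edges P then t_coord N P Q d else 0,
      \<lambda>v. if v \<in> vertices P \<and> vertex_in N P v Q \<notin> N then 1 else 0)"

end

theory Submission
  imports Defs
begin

text \<open>
  Since \<open>t \<ge> 0\<close>, the map \<open>\<psi>(\<xi>, _)\<close> is monotone along every edge path that descends for a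
  linear functional \<open>c\<close>. Hence a vertex minimising \<open>c\<close> on \<open>P\<close> is sent to a point minimising
  \<open>c\<close> on \<open>P\<^sub>\<xi>\<close>, so \<open>w(P\<^sub>\<xi>) = \<psi>(\<xi>, w)\<close>, and these points add up to \<open>w\<close> over the
  \<open>\<xi>\<^sub>i\<close>. Independence of the path is proved by induction along a generic \<open>c\<close>: the lower
  neighbours of a vertex are linked through compact 2-faces with that vertex on top, because the vertices
  of the vertex figure in an open half-space are connected by edges in it.

  Along an edge, \<open>\<psi>(\<xi>, v) - s\<^sub>v v\<close> changes by the vector whose integrality defines
  \<open>T\<^sub>\<int>(P)\<close>, so (i) says that all \<open>s\<^sub>v\<close> are integers and all \<open>\<psi>(\<xi>, v) - s\<^sub>v v\<close> lie
  in \<open>N\<close>. As the \<open>s\<^sub>v(\<xi>\<^sub>i)\<close> are nonnegative with sum 1 for \<open>v \<notin> N\<close>, exactly one of them is then 1,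
  and the summands of index different from that one have a lattice point at \<open>v\<close>.
\<close>

section \<open>Polyhedra given by inequalities\<close>

text \<open>\<open>P\<close> may be unbounded, while only compact edges and compact 2-faces carry
  data. So the graph of compact edges has to be connected, and path independence has to follow from
  compact 2-faces alone. Both rest on one fact: a functional \<open>c\<close> that is nonnegative on
  the recession cone is bounded below on \<open>P\<close>, so an edge or 2-face leaving a vertex in
  directions of negative \<open>c\<close> cannot run to infinity.

  Descent along edges needs a unique lowest vertex. Where a functional may have ties, it is
  perturbed by the sum of the normals active at the chosen vertex; that sum is positive on every
  nonzero direction of the tangent cone.

  The path chosen by \<open>SOME\<close> in \<open>psi\<close> is eliminated by constructing a
  potential: a function on the vertices with the prescribed difference along each compact edge.
  After that only these differences and the value at \<open>v0\<close> are used.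

  For the way from (ii) back to (i): if \<open>w(P\<^sub>\<xi>)\<close> is not in \<open>N\<close>
  for one summand, it is in \<open>N\<close> for all others. Since these points add up to
  \<open>w\<close>, the exceptional one is congruent to \<open>w\<close> modulo
  \<open>N\<close>.\<close>

definition hpoly :: "('a::euclidean_space \<times> real) set \<Rightarrow> 'a set" where
  "hpoly A = {x. \<forall>h\<in>A. snd h \<le> fst h \<bullet> x}"

text \<open>The recession cone, read off from the inequalities; it is the tail as soon as
  \<open>hpoly A\<close> is nonempty.\<close>

definition hrec :: "('a::euclidean_space \<times> real) set \<Rightarrow> 'a set" where
  "hrec A = {a. \<forall>h\<in>A. 0 \<le> fst h \<bullet> a}"

definition active :: "('a::euclidean_space \<times> real) set \<Rightarrow> 'a \<Rightarrow> ('a \<times> real) set" where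
  "active A x = {h\<in>A. fst h \<bullet> x = snd h}"

text \<open>For \<open>x\<close> in \<open>hpoly A\<close> this is the direction space of the
  smallest face containing \<open>x\<close>.\<close>

definition lin :: "('a::euclidean_space \<times> real) set \<Rightarrow> 'a \<Rightarrow> 'a set" where
  "lin A x = {d. \<forall>h\<in>active A x. fst h \<bullet> d = 0}"

text \<open>The lineality space is zero, which for nonempty \<open>hpoly A\<close> makes vertices
  exist.\<close>

definition pointed :: "('a::euclidean_space \<times> real) set \<Rightarrow> bool" where
  "pointed A \<longleftrightarrow> (\<forall>a. (\<forall>h\<in>A. fst h \<bullet> a = 0) \<longrightarrow> a = 0)"

lemma polyhedron_imp_hpoly:
  assumes "polyhedron P"
  obtains A where "finite A" "P = hpoly A"
proof -
  obtain F where F: "finite F" "P = \<Inter>F" "\<forall>h\<in>F. \<exists>a b. a \<noteq> 0 \<and> h = {x. a \<bullet> x \<le> b}"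
    using assms unfolding polyhedron_def by blast
  then obtain a b where ab: "\<And>h. h \<in> F \<Longrightarrow> h = {x. a h \<bullet> x \<le> b h}"
    by metis
  have "P = hpoly ((\<lambda>h. (- a h, - b h)) ` F)"
    using F(2) ab by (fastforce simp: hpoly_def)
  with F(1) that show thesis by blast
qed

lemma convex_hpoly: "convex (hpoly A)"
proof -
  have "hpoly A = (\<Inter>h\<in>A. {x. fst h \<bullet> x \<ge> snd h})"
    by (auto simp: hpoly_def)
  then show ?thesis
    by (auto intro!: convex_INT convex_halfspace_ge)
qed

lemma closed_hpoly: "closed (hpoly A)"
proof -
  have "hpoly A = (\<Inter>h\<in>A. {x. fst h \<bullet> x \<ge> snd h})"
    by (auto simp: hpoly_def)
  then show ?thesis
    by (auto intro!: closed_INT closed_halfspace_ge)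
qed

lemma polyhedron_hpoly: "finite A \<Longrightarrow> polyhedron (hpoly A)"
proof -
  assume "finite A"
  moreover have "hpoly A = \<Inter>((\<lambda>h. {x. fst h \<bullet> x \<ge> snd h}) ` A)"
    by (auto simp: hpoly_def)
  ultimately show ?thesis
    by (auto intro!: polyhedron_Inter polyhedron_halfspace_ge)
qed

lemma finite_vertices: "finite A \<Longrightarrow> finite (vertices (hpoly A))"
  unfolding vertices_def by (intro finite_polyhedron_extreme_points polyhedron_hpoly)

lemma vertices_subset: "vertices P \<subseteq> P"
  by (auto simp: vertices_def extreme_point_of_def)

lemma hrec_add: "a \<in> hrec A \<Longrightarrow> b \<in> hrec A \<Longrightarrow> a + b \<in> hrec A"
  by (auto simp: hrec_def inner_add_right)

lemma hrec_scaleR: "a \<in> hrec A \<Longrightarrow> 0 \<le> c \<Longrightarrow> c *\<^sub>R a \<in> hrec A"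
  by (auto simp: hrec_def)

lemma hrec_zero: "0 \<in> hrec A"
  by (auto simp: hrec_def)

lemma hpoly_add_hrec: "x \<in> hpoly A \<Longrightarrow> a \<in> hrec A \<Longrightarrow> x + a \<in> hpoly A"
  unfolding hpoly_def hrec_def by (force simp: inner_add_right)

lemma hrec_eq_hpoly: "hrec A = hpoly ((\<lambda>h. (fst h, 0)) ` A)"
  by (auto simp: hrec_def hpoly_def)

lemma polyhedron_hrec: "finite A \<Longrightarrow> polyhedron (hrec A)"
  by (simp add: hrec_eq_hpoly polyhedron_hpoly)

lemma real_unbounded_contradiction:
  fixes x y :: real
  assumes "y < 0" and "\<And>n::nat. b \<le> x + real n * y"
  shows False
proof -
  obtain n :: nat where "real n > (x - b) / (- y)"
    using reals_Archimedean2 by blast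
  with \<open>y < 0\<close> have "x - b < real n * (- y)"
    by (simp add: field_simps)
  with assms(2)[of n] show False by simp
qed

lemma tail_iterate:
  assumes "a \<in> tail P" "x \<in> P"
  shows "x + real n *\<^sub>R a \<in> P"
proof (induction n)
  case (Suc n)
  then have "a + (x + real n *\<^sub>R a) \<in> P"
    using assms(1) by (auto simp: tail_def)
  then show ?case by (simp add: algebra_simps)
qed (use assms in simp)

text \<open>An inequality that decreases along a tail vector would be violated after enough steps
  from any starting point.\<close>

lemma tail_hpoly:
  assumes "hpoly A \<noteq> {}"
  shows "tail (hpoly A) = hrec A"
proof
  show "hrec A \<subseteq> tail (hpoly A)"
    unfolding tail_def using hpoly_add_hrec by (fastforce simp: add.commute)
  obtain x where x: "x \<in> hpoly A" using assms by auto
  show "tail (hpoly A) \<subseteq> hrec A"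
  proof
    fix a assume a: "a \<in> tail (hpoly A)"
    have "0 \<le> fst h \<bullet> a" if h: "h \<in> A" for h
    proof (rule ccontr)
      assume "\<not> 0 \<le> fst h \<bullet> a"
      moreover have "snd h \<le> fst h \<bullet> x + real n * (fst h \<bullet> a)" for n
        using tail_iterate[OF a x, of n] h by (auto simp: hpoly_def inner_add_right)
      ultimately show False
        using real_unbounded_contradiction[of "fst h \<bullet> a"] by auto
    qed
    then show "a \<in> hrec A" by (simp add: hrec_def)
  qed
qed

section \<open>Active inequalities, small steps and vertices\<close>

lemma lin_scaleR: "d \<in> lin A x \<Longrightarrow> c *\<^sub>R d \<in> lin A x"
  by (auto simp: lin_def)

lemma subspace_lin: "subspace (lin A x)"
  by (auto simp: lin_def subspace_def inner_add_right)

text \<open>Slack inequalities survive a small step, and an active one becomes strict exactly when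
  \<open>d\<close> has positive product with its normal. The exact active set is recorded because it
  determines the face that the moved point lies on.\<close>

lemma eventually_nudge:
  assumes "finite A" "x \<in> hpoly A" "\<forall>h\<in>active A x. 0 \<le> fst h \<bullet> d"
  shows "eventually (\<lambda>e. x + e *\<^sub>R d \<in> hpoly A \<and>
           active A (x + e *\<^sub>R d) = {h\<in>active A x. fst h \<bullet> d = 0}) (at_right (0::real))"
proof -
  have "eventually (\<lambda>e. snd h \<le> fst h \<bullet> (x + e *\<^sub>R d) \<and>
          (fst h \<bullet> (x + e *\<^sub>R d) = snd h \<longleftrightarrow> h \<in> active A x \<and> fst h \<bullet> d = 0)) (at_right (0::real))"
    if h: "h \<in> A" for h
  proof (cases "h \<in> active A x")
    case True
    then show ?thesis
      using assms(3) eventually_at_right_less[of "0::real"]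
      by (auto simp: active_def inner_add_right elim!: eventually_mono)
  next
    case False
    then have "snd h < fst h \<bullet> x"
      using h assms(2) by (fastforce simp: active_def hpoly_def)
    moreover have "((\<lambda>e. fst h \<bullet> (x + e *\<^sub>R d)) \<longlongrightarrow> fst h \<bullet> (x + 0 *\<^sub>R d)) (at_right (0::real))"
      by (intro tendsto_intros)
    ultimately have "eventually (\<lambda>e. snd h < fst h \<bullet> (x + e *\<^sub>R d)) (at_right (0::real))"
      by (auto intro: order_tendstoD)
    then show ?thesis
      using False by (auto elim!: eventually_mono)
  qed
  then have "eventually (\<lambda>e. \<forall>h\<in>A. snd h \<le> fst h \<bullet> (x + e *\<^sub>R d) \<and>
          (fst h \<bullet> (x + e *\<^sub>R d) = snd h \<longleftrightarrow> h \<in> active A x \<and> fst h \<bullet> d = 0)) (at_right (0::real))"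
    using assms(1) by (intro eventually_ball_finite) auto
  then show ?thesis
    by (rule eventually_mono) (auto simp: hpoly_def active_def)
qed

lemma nudge:
  assumes "finite A" "x \<in> hpoly A" "\<forall>h\<in>active A x. 0 \<le> fst h \<bullet> d"
  obtains e where "0 < e" "x + e *\<^sub>R d \<in> hpoly A"
    "active A (x + e *\<^sub>R d) = {h\<in>active A x. fst h \<bullet> d = 0}"
proof -
  have "eventually (\<lambda>e. 0 < e \<and> x + e *\<^sub>R d \<in> hpoly A \<and>
           active A (x + e *\<^sub>R d) = {h\<in>active A x. fst h \<bullet> d = 0}) (at_right (0::real))"
    using eventually_nudge[OF assms] eventually_at_right_less[of "0::real"]
    by eventually_elim auto
  then have "\<exists>e. 0 < e \<and> x + e *\<^sub>R d \<in> hpoly A \<and>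
           active A (x + e *\<^sub>R d) = {h\<in>active A x. fst h \<bullet> d = 0}"
    by (rule eventually_happens'[rotated]) simp
  with that show thesis by blast
qed

lemma nudge_both:
  assumes "finite A" "x \<in> hpoly A" "d \<in> lin A x"
  obtains e where "0 < e" "x + e *\<^sub>R d \<in> hpoly A" "x - e *\<^sub>R d \<in> hpoly A"
proof -
  have "eventually (\<lambda>e. x + e *\<^sub>R d \<in> hpoly A) (at_right (0::real))"
    using eventually_nudge[of A x d] assms by (auto simp: lin_def elim: eventually_mono)
  moreover have "eventually (\<lambda>e. x - e *\<^sub>R d \<in> hpoly A) (at_right (0::real))"
    using eventually_nudge[of A x "-d"] assms by (auto simp: lin_def elim: eventually_mono)
  ultimately have "eventually (\<lambda>e. 0 < e \<and> x + e *\<^sub>R d \<in> hpoly A \<and> x - e *\<^sub>R d \<in> hpoly A) (at_right (0::real))"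
    using eventually_at_right_less[of "0::real"] by eventually_elim auto
  then have "\<exists>e. 0 < e \<and> x + e *\<^sub>R d \<in> hpoly A \<and> x - e *\<^sub>R d \<in> hpoly A"
    by (rule eventually_happens'[rotated]) simp
  with that show thesis by blast
qed

lemma mem_open_segment_sym:
  fixes x d :: "'a::real_vector"
  assumes "d \<noteq> 0"
  shows "x \<in> open_segment (x - d) (x + d)"
proof -
  have "x = (1 - 1/2) *\<^sub>R (x - d) + (1/2) *\<^sub>R (x + d)"
    by (simp add: algebra_simps flip: scaleR_add_left)
  moreover have "x - d \<noteq> x + d"
  proof
    assume "x - d = x + d"
    then have "2 *\<^sub>R d = 0" by (simp add: algebra_simps scaleR_2)
    with assms show False by simp
  qed
  ultimately show ?thesis
    unfolding in_segment by (intro conjI exI[of _ "1/2"]) auto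
qed

text \<open>Two nonnegative slacks whose combination with positive weights vanishes are both zero.
  This is why sets cut out by tight inequalities are faces.\<close>

lemma active_open_segment:
  assumes "a \<in> hpoly A" "b \<in> hpoly A" "x \<in> open_segment a b"
  shows "active A x \<subseteq> active A a \<inter> active A b"
proof
  fix h assume h: "h \<in> active A x"
  obtain u where u: "0 < u" "u < 1" "x = (1 - u) *\<^sub>R a + u *\<^sub>R b"
    using assms(3) unfolding in_segment by blast
  have ineq: "0 \<le> fst h \<bullet> a - snd h" "0 \<le> fst h \<bullet> b - snd h"
    using h assms by (auto simp: hpoly_def active_def)
  have "(1 - u) * (fst h \<bullet> a - snd h) + u * (fst h \<bullet> b - snd h) = 0"
    using h u(3) by (auto simp: active_def inner_add_right algebra_simps)
  moreover have "0 \<le> (1 - u) * (fst h \<bullet> a - snd h)" "0 \<le> u * (fst h \<bullet> b - snd h)"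
    using u ineq by auto
  ultimately have "(1 - u) * (fst h \<bullet> a - snd h) = 0" "u * (fst h \<bullet> b - snd h) = 0"
    by linarith+
  then show "h \<in> active A a \<inter> active A b"
    using u h by (auto simp: active_def)
qed

text \<open>A nonzero direction in \<open>lin A v\<close> allows a small step both ways, so
  \<open>v\<close> is not extreme. Conversely the endpoints of a segment through \<open>v\<close>
  differ by an element of \<open>lin A v\<close>.\<close>

lemma vertices_hpoly_iff:
  assumes "finite A"
  shows "v \<in> vertices (hpoly A) \<longleftrightarrow> v \<in> hpoly A \<and> lin A v = {0}"
proof
  assume v: "v \<in> vertices (hpoly A)"
  then have vP: "v \<in> hpoly A" and ex: "\<And>a b. a \<in> hpoly A \<Longrightarrow> b \<in> hpoly A \<Longrightarrow> v \<notin> open_segment a b"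
    by (auto simp: vertices_def extreme_point_of_def)
  have "d = 0" if "d \<in> lin A v" for d
  proof (rule ccontr)
    assume "d \<noteq> 0"
    obtain e where e: "0 < e" "v + e *\<^sub>R d \<in> hpoly A" "v - e *\<^sub>R d \<in> hpoly A"
      using nudge_both[OF assms vP \<open>d \<in> lin A v\<close>] .
    with ex[of "v - e *\<^sub>R d" "v + e *\<^sub>R d"] mem_open_segment_sym[of "e *\<^sub>R d" v] \<open>d \<noteq> 0\<close>
    show False by simp
  qed
  moreover have "0 \<in> lin A v" by (simp add: lin_def)
  ultimately show "v \<in> hpoly A \<and> lin A v = {0}" using vP by blast
next
  assume v: "v \<in> hpoly A \<and> lin A v = {0}"
  have "v \<notin> open_segment a b" if ab: "a \<in> hpoly A" "b \<in> hpoly A" for a b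
  proof
    assume seg: "v \<in> open_segment a b"
    have "b - a \<in> lin A v"
      using active_open_segment[OF ab seg] by (fastforce simp: lin_def active_def inner_diff_right)
    with v have "a = b" by auto
    with seg show False by simp
  qed
  with v show "v \<in> vertices (hpoly A)"
    by (auto simp: vertices_def extreme_point_of_def)
qed

lemma vertex_pointed:
  assumes "finite A" "v \<in> vertices (hpoly A)"
  shows "pointed A"
proof -
  have "a \<in> lin A v" if "\<forall>h\<in>A. fst h \<bullet> a = 0" for a
    using that unfolding lin_def active_def by blast
  then show ?thesis using assms by (auto simp: vertices_hpoly_iff pointed_def)
qed

section \<open>Decomposition into the hull of the vertices and the recession cone\<close>

lemma ray_exit:
  assumes A: "finite A" and x: "x \<in> hpoly A" and d: "d \<notin> hrec A"
  obtains s where "0 \<le> s" "x + s *\<^sub>R d \<in> hpoly A" "\<exists>h\<in>active A (x + s *\<^sub>R d). fst h \<bullet> d < 0"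
proof -
  let ?B = "{h\<in>A. fst h \<bullet> d < 0}"
  \<comment> \<open>The step length at which \<open>h\<close> becomes tight; the smallest one among
    the inequalities that decrease along \<open>d\<close> is where the ray leaves.\<close>
  define r where "r h = (fst h \<bullet> x - snd h) / (- (fst h \<bullet> d))" for h :: "'a \<times> real"
  have fin: "finite ?B" "?B \<noteq> {}"
    using A d by (auto simp: hrec_def not_le)
  then obtain h where h: "h \<in> ?B" "\<And>g. g \<in> ?B \<Longrightarrow> r h \<le> r g"
    using arg_min_if_finite(1)[OF fin, of r] arg_min_least[OF fin, of _ r] by blast
  have pos: "0 \<le> r h"
    using h(1) x by (auto simp: r_def hpoly_def intro!: divide_nonneg_nonpos)
  have eq: "fst h \<bullet> (x + r h *\<^sub>R d) = snd h"
    using h(1) by (simp add: r_def inner_diff_right)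
  have "snd g \<le> fst g \<bullet> (x + r h *\<^sub>R d)" if g: "g \<in> A" for g
  proof (cases "fst g \<bullet> d < 0")
    case True
    then have "r h \<le> (fst g \<bullet> x - snd g) / (- (fst g \<bullet> d))"
      using h(2) g by (auto simp: r_def)
    then have "r h * (- (fst g \<bullet> d)) \<le> fst g \<bullet> x - snd g"
      using True by (subst (asm) pos_le_divide_eq) auto
    then show ?thesis by (simp add: inner_add_right)
  next
    case False
    then have "0 \<le> r h * (fst g \<bullet> d)" using pos by simp
    moreover have "snd g \<le> fst g \<bullet> x" using x g by (auto simp: hpoly_def)
    ultimately show ?thesis by (simp add: inner_add_right)
  qed
  then have "x + r h *\<^sub>R d \<in> hpoly A" by (auto simp: hpoly_def)
  moreover have "h \<in> active A (x + r h *\<^sub>R d)" using h(1) eq by (simp add: active_def)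
  ultimately show thesis using that[OF pos] h(1) by blast
qed

text \<open>
  A non-vertex moves along a direction of its face until a further inequality becomes tight;
  induction on the number of inequalities that are not tight.
\<close>

lemma hpoly_decomposition:
  assumes A: "finite A" and pt: "pointed A" and "x \<in> hpoly A"
  shows "x \<in> convex hull (vertices (hpoly A)) + hrec A"
  using assms(3)
proof (induction "card (A - active A x)" arbitrary: x rule: less_induct)
  case less
  note x = less.prems
  let ?C = "convex hull (vertices (hpoly A)) + hrec A"
  show ?case
  proof (cases "lin A x = {0}")
    case True
    then have "x \<in> vertices (hpoly A)" using x A by (simp add: vertices_hpoly_iff)
    then have "x + 0 \<in> ?C" by (intro set_plus_intro hull_inc hrec_zero)
    then show ?thesis by simp
  next
    case False
    moreover have "0 \<in> lin A x" by (simp add: lin_def)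
    ultimately obtain d where d: "d \<in> lin A x" "d \<noteq> 0" by blast
    have exit: "\<exists>s\<ge>0. x + s *\<^sub>R f \<in> ?C" if f: "f \<in> lin A x" "f \<notin> hrec A" for f
    proof -
      obtain s where s: "0 \<le> s" "x + s *\<^sub>R f \<in> hpoly A" "\<exists>h\<in>active A (x + s *\<^sub>R f). fst h \<bullet> f < 0"
        using ray_exit[OF A x f(2)] .
      have "active A x \<subseteq> active A (x + s *\<^sub>R f)"
        using f(1) by (auto simp: active_def lin_def inner_add_right)
      moreover have "active A x \<noteq> active A (x + s *\<^sub>R f)"
        using f(1) s(3) unfolding lin_def by force
      ultimately have "active A x \<subset> active A (x + s *\<^sub>R f)" by blast
      then have "card (A - active A (x + s *\<^sub>R f)) < card (A - active A x)"
        using A by (intro psubset_card_mono) (auto simp: active_def)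
      from less.hyps[OF this s(2)] s(1) show ?thesis by blast
    qed
    have "d \<notin> hrec A \<or> - d \<notin> hrec A"
      using pt d(2) unfolding pointed_def hrec_def by fastforce
    \<comment> \<open>If \<open>- f\<close> is a recession direction, the way back from the exit
      point to \<open>x\<close> only adds to the recession part. If neither direction is one, both
      rays exit and \<open>x\<close> lies between the two exit points.\<close>
    then consider f where "f \<in> lin A x" "f \<notin> hrec A" "- f \<in> hrec A" | "d \<notin> hrec A" "- d \<notin> hrec A"
      using d(1) lin_scaleR[OF d(1), of "-1"] by force
    then show ?thesis
    proof cases
      case (1 f)
      obtain s where s: "s \<ge> 0" "x + s *\<^sub>R f \<in> ?C" using exit 1 by blast
      then obtain y a where ya: "y \<in> convex hull (vertices (hpoly A))" "a \<in> hrec A" "x + s *\<^sub>R f = y + a"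
        by (auto elim: set_plus_elim)
      have "x = y + (a + s *\<^sub>R (- f))" using ya(3) by (simp add: algebra_simps)
      moreover have "a + s *\<^sub>R (- f) \<in> hrec A"
        using ya(2) 1(3) s(1) by (intro hrec_add hrec_scaleR)
      ultimately show ?thesis using ya(1) by (metis set_plus_intro)
    next
      case 2
      obtain s where s: "s \<ge> 0" "x + s *\<^sub>R d \<in> ?C" using exit 2 d by blast
      obtain r where r: "r \<ge> 0" "x + r *\<^sub>R (- d) \<in> ?C"
        using exit[of "- d"] 2 lin_scaleR[OF d(1), of "-1"] by auto
      have "convex (hrec A)" using polyhedron_hrec[OF A] by (rule polyhedron_imp_convex)
      then have cvx: "convex ?C" by (intro convex_set_plus convex_convex_hull)
      show ?thesis
      proof (cases "s + r = 0")
        case True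
        then show ?thesis using s r by (auto simp: add_nonneg_eq_0_iff)
      next
        case False
        then have sr: "s + r > 0" using s r by linarith
        have "(r / (s + r)) *\<^sub>R (x + s *\<^sub>R d) + (s / (s + r)) *\<^sub>R (x + r *\<^sub>R (- d)) \<in> ?C"
          using sr s r by (intro convexD[OF cvx]) (auto simp flip: add_divide_distrib)
        also have "(r / (s + r)) *\<^sub>R (x + s *\<^sub>R d) + (s / (s + r)) *\<^sub>R (x + r *\<^sub>R (- d))
            = (r / (s + r) + s / (s + r)) *\<^sub>R x"
          by (simp add: algebra_simps)
        also have "r / (s + r) + s / (s + r) = 1"
          using sr by (simp flip: add_divide_distrib add: add.commute)
        finally show ?thesis by simp
      qed
    qed
  qed
qed

section \<open>Minimising linear functionals and exposing vertices\<close>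

lemma hull_halfspace_ge:
  assumes "\<And>v. v \<in> V \<Longrightarrow> b \<le> c \<bullet> v" "x \<in> convex hull V"
  shows "b \<le> c \<bullet> x"
proof -
  have "convex hull V \<subseteq> {x. c \<bullet> x \<ge> b}"
    using assms(1) by (intro hull_minimal convex_halfspace_ge) auto
  with assms(2) show ?thesis by auto
qed

text \<open>By the decomposition, the least value at the finitely many vertices bounds
  \<open>c\<close> on their hull, and recession vectors cannot lower it.\<close>

lemma vertex_minimum:
  assumes A: "finite A" "pointed A" "hpoly A \<noteq> {}" and c: "\<And>a. a \<in> hrec A \<Longrightarrow> 0 \<le> c \<bullet> a"
  obtains w where "w \<in> vertices (hpoly A)" "\<And>x. x \<in> hpoly A \<Longrightarrow> c \<bullet> w \<le> c \<bullet> x"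
proof -
  let ?V = "vertices (hpoly A)"
  have V: "finite ?V" "?V \<noteq> {}"
    using finite_vertices[OF A(1)] A(3) hpoly_decomposition[OF A(1,2)]
    by (auto elim!: set_plus_elim)
  obtain w where w: "w \<in> ?V" "\<And>v. v \<in> ?V \<Longrightarrow> c \<bullet> w \<le> c \<bullet> v"
    using arg_min_if_finite(1)[OF V, of "\<lambda>v. c \<bullet> v"] arg_min_least[OF V, of _ "\<lambda>v. c \<bullet> v"] by blast
  have "c \<bullet> w \<le> c \<bullet> x" if x: "x \<in> hpoly A" for x
  proof -
    obtain y a where ya: "y \<in> convex hull ?V" "a \<in> hrec A" "x = y + a"
      using hpoly_decomposition[OF A(1,2) x] by (auto elim: set_plus_elim)
    have "c \<bullet> w \<le> c \<bullet> y" using hull_halfspace_ge[OF w(2) ya(1)] .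
    with c[OF ya(2)] ya(3) show ?thesis by (simp add: inner_add_right)
  qed
  with w(1) that show thesis by blast
qed

text \<open>The sum of the inward normals of the inequalities tight at \<open>v\<close>; for a
  vertex it lies in the interior of the normal cone.\<close>

definition exposer :: "('a::euclidean_space \<times> real) set \<Rightarrow> 'a \<Rightarrow> 'a" where
  "exposer A v = (\<Sum>h\<in>active A v. fst h)"

lemma exposer_nonneg:
  assumes "\<And>h. h \<in> active A v \<Longrightarrow> 0 \<le> fst h \<bullet> d"
  shows "0 \<le> exposer A v \<bullet> d"
  unfolding exposer_def inner_sum_left using assms by (intro sum_nonneg)

text \<open>Nonnegative summands with total at most 0 all vanish, which puts \<open>d\<close> into
  \<open>lin A v\<close>. Since \<open>d\<close> ranges over the whole tangent cone, this covers
  differences \<open>x - v\<close> as well as recession vectors.\<close>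

lemma exposer_eq_0:
  assumes "finite A" "v \<in> vertices (hpoly A)"
    and "\<And>h. h \<in> active A v \<Longrightarrow> 0 \<le> fst h \<bullet> d" and "exposer A v \<bullet> d \<le> 0"
  shows "d = 0"
proof -
  have fin: "finite (active A v)" using assms(1) by (simp add: active_def)
  have "exposer A v \<bullet> d = 0"
    using exposer_nonneg[of A v d] assms(3,4) by auto
  then have "\<forall>h\<in>active A v. fst h \<bullet> d = 0"
    using sum_nonneg_eq_0_iff[OF fin, of "\<lambda>h. fst h \<bullet> d"] assms(3)
    by (simp add: exposer_def inner_sum_left)
  then have "d \<in> lin A v" by (simp add: lin_def)
  then show ?thesis using assms(1,2) by (simp add: vertices_hpoly_iff)
qed

lemma exposer_min:
  assumes "x \<in> hpoly A"
  shows "exposer A v \<bullet> v \<le> exposer A v \<bullet> x"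
  using exposer_nonneg[of A v "x - v"] assms
  by (auto simp: inner_diff_right active_def hpoly_def)

lemma exposer_unique:
  assumes "finite A" "v \<in> vertices (hpoly A)" "x \<in> hpoly A" "exposer A v \<bullet> x \<le> exposer A v \<bullet> v"
  shows "x = v"
  using exposer_eq_0[OF assms(1,2), of "x - v"] assms(3,4)
  by (auto simp: inner_diff_right active_def hpoly_def)

lemma exposer_hrec_nonneg: "a \<in> hrec A \<Longrightarrow> 0 \<le> exposer A v \<bullet> a"
  by (rule exposer_nonneg) (auto simp: hrec_def active_def)

lemma exposer_hrec_pos:
  assumes "finite A" "v \<in> vertices (hpoly A)" "a \<in> hrec A" "a \<noteq> 0"
  shows "0 < exposer A v \<bullet> a"
  using exposer_eq_0[OF assms(1,2), of a] assms(3,4) by (force simp: hrec_def active_def not_less)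

section \<open>Faces and the vertex figure\<close>

text \<open>The smallest face containing \<open>x\<close>, for \<open>x\<close> in
  \<open>hpoly A\<close>.\<close>

definition act_face :: "('a::euclidean_space \<times> real) set \<Rightarrow> 'a \<Rightarrow> 'a set" where
  "act_face A x = {y\<in>hpoly A. active A x \<subseteq> active A y}"

lemma act_face_eq: "act_face A x = hpoly A \<inter> (\<Inter>h\<in>active A x. {y. fst h \<bullet> y = snd h})"
  unfolding act_face_def by (auto simp: active_def)

lemma closed_act_face: "closed (act_face A x)"
  unfolding act_face_eq by (intro closed_Int closed_hpoly closed_INT ballI closed_hyperplane)

lemma act_face_face_of: "act_face A x face_of hpoly A"
proof -
  have "convex (act_face A x)"
    unfolding act_face_eq by (intro convex_Int convex_hpoly convex_INT convex_hyperplane)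
  then show ?thesis
    unfolding face_of_def act_face_def using active_open_segment by blast
qed

lemma mem_act_face_iff:
  "x \<in> hpoly A \<Longrightarrow> y \<in> act_face A x \<longleftrightarrow> y \<in> hpoly A \<and> y - x \<in> lin A x"
  by (fastforce simp: act_face_def lin_def active_def inner_diff_right)

text \<open>Each direction in \<open>lin A x\<close> is realised by a short step inside the face, so
  the hull fills the whole translate.\<close>

lemma affine_hull_act_face:
  assumes "finite A" "x \<in> hpoly A"
  shows "affine hull (act_face A x) = (\<lambda>d. x + d) ` lin A x"
proof
  have "affine ((\<lambda>d. x + d) ` lin A x)"
    by (simp add: affine_translation[symmetric] subspace_imp_affine subspace_lin)
  moreover have "act_face A x \<subseteq> (\<lambda>d. x + d) ` lin A x"
    using mem_act_face_iff[OF assms(2)] by (force simp: image_iff)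
  ultimately show "affine hull (act_face A x) \<subseteq> (\<lambda>d. x + d) ` lin A x"
    by (rule hull_minimal[rotated])
  show "(\<lambda>d. x + d) ` lin A x \<subseteq> affine hull (act_face A x)"
  proof
    fix y assume "y \<in> (\<lambda>d. x + d) ` lin A x"
    then obtain d where d: "d \<in> lin A x" "y = x + d" by auto
    obtain e where e: "0 < e" "x + e *\<^sub>R d \<in> hpoly A"
      using nudge_both[OF assms d(1)] .
    have "x \<in> act_face A x" "x + e *\<^sub>R d \<in> act_face A x"
      using mem_act_face_iff[OF assms(2)] assms(2) e(2) lin_scaleR[OF d(1)] subspace_0[OF subspace_lin]
      by auto
    then have "(1 - 1 / e) *\<^sub>R x + (1 / e) *\<^sub>R (x + e *\<^sub>R d) \<in> affine hull (act_face A x)"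
      by (intro mem_affine[OF affine_affine_hull]) (auto intro: hull_inc)
    then show "y \<in> affine hull (act_face A x)"
      using e(1) d(2) by (simp add: algebra_simps)
  qed
qed

lemma aff_dim_act_face:
  assumes "finite A" "x \<in> hpoly A"
  shows "aff_dim (act_face A x) = int (dim (lin A x))"
  using affine_hull_act_face[OF assms]
  by (metis aff_dim_affine_hull aff_dim_translation_eq aff_dim_subspace subspace_lin)

section \<open>Compact edges and the vertex figure\<close>

lemma compact_edge_vertices:
  assumes "closed_segment v u \<in> compact_edges P"
  shows "v \<in> vertices P" "u \<in> vertices P" "v \<noteq> u"
proof -
  have d: "closed_segment v u face_of P" "aff_dim (closed_segment v u) = 1"
    using assms by (auto simp: compact_edges_def edge_of_def)
  show "v \<in> vertices P" "u \<in> vertices P"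
    using extreme_point_of_face[OF d(1)] by (auto simp: vertices_def extreme_point_of_segment)
  show "v \<noteq> u" using d(2) by auto
qed

lemma compact_edge_obtain:
  assumes "d \<in> compact_edges P"
  obtains v w where "d = closed_segment v w"
proof -
  have d: "d face_of P" "aff_dim d = 1" "compact d"
    using assms by (auto simp: compact_edges_def edge_of_def)
  then have "convex d" "d \<noteq> {}" "collinear d"
    by (auto simp: face_of_imp_convex collinear_aff_dim)
  then show thesis
    using compact_convex_collinear_segment[of d] d(3) that by blast
qed

text \<open>A symmetric step from the midpoint stays in \<open>hpoly A\<close>, and extremality of
  the face forces it to stay on the segment.\<close>

lemma segment_face_lin:
  assumes A: "finite A" and F: "closed_segment p q face_of hpoly A" and e: "e \<in> lin A (midpoint p q)"
  shows "\<exists>k. e = k *\<^sub>R (q - p)"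
proof (cases "e = 0")
  case False
  let ?m = "midpoint p q"
  have mid: "?m = p + (1/2) *\<^sub>R (q - p)"
    by (rule euclidean_eqI) (simp add: midpoint_def inner_simps field_simps)
  have m: "?m \<in> closed_segment p q" by simp
  then have "?m \<in> hpoly A" using F face_of_imp_subset by blast
  then obtain r where r: "0 < r" "?m + r *\<^sub>R e \<in> hpoly A" "?m - r *\<^sub>R e \<in> hpoly A"
    using nudge_both[OF A _ e] by blast
  then have "?m + r *\<^sub>R e \<in> closed_segment p q"
    using F m mem_open_segment_sym[of "r *\<^sub>R e" ?m] False unfolding face_of_def
    by (metis less_irrefl scaleR_eq_0_iff)
  then obtain u where "?m + r *\<^sub>R e = (1 - u) *\<^sub>R p + u *\<^sub>R q"
    unfolding in_segment by blast
  then have "r *\<^sub>R e = (u - 1/2) *\<^sub>R (q - p)"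
    unfolding mid by (simp add: algebra_simps)
  then have "(1 / r) *\<^sub>R (r *\<^sub>R e) = (1 / r) *\<^sub>R ((u - 1/2) *\<^sub>R (q - p))" by simp
  then have "e = ((u - 1/2) / r) *\<^sub>R (q - p)" using r(1) by simp
  then show ?thesis by blast
qed (auto intro: exI[of _ 0])

text \<open>The slice of the tangent cone at \<open>v\<close> by the hyperplane where the exposing
  functional is 1. Its points are directions at \<open>v\<close>, not points of the polyhedron; the
  last two inequalities together encode the hyperplane equation.\<close>

definition vertex_figure :: "('a::euclidean_space \<times> real) set \<Rightarrow> 'a \<Rightarrow> ('a \<times> real) set" where
  "vertex_figure A v = (\<lambda>h. (fst h, 0)) ` active A v \<union> {(exposer A v, 1), (- exposer A v, - 1)}"

lemma finite_vertex_figure: "finite A \<Longrightarrow> finite (vertex_figure A v)"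
  by (simp add: vertex_figure_def active_def)

lemma mem_hpoly_vertex_figure:
  "d \<in> hpoly (vertex_figure A v) \<longleftrightarrow> exposer A v \<bullet> d = 1 \<and> (\<forall>h\<in>active A v. 0 \<le> fst h \<bullet> d)"
  by (auto simp: hpoly_def vertex_figure_def)

lemma hrec_vertex_figure:
  assumes "finite A" "v \<in> vertices (hpoly A)"
  shows "hrec (vertex_figure A v) = {0}"
proof -
  have "a = 0" if "a \<in> hrec (vertex_figure A v)" for a
    using exposer_eq_0[OF assms, of a] that by (force simp: hrec_def vertex_figure_def)
  then show ?thesis using hrec_zero by blast
qed

lemma pointed_vertex_figure:
  assumes "finite A" "v \<in> vertices (hpoly A)"
  shows "pointed (vertex_figure A v)"
  using hrec_vertex_figure[OF assms] by (force simp: pointed_def hrec_def)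

lemma lin_vertex_figure:
  assumes "d \<in> hpoly (vertex_figure A v)"
  shows "lin (vertex_figure A v) d =
    {e. exposer A v \<bullet> e = 0 \<and> (\<forall>h\<in>active A v. fst h \<bullet> d = 0 \<longrightarrow> fst h \<bullet> e = 0)}"
proof -
  have "active (vertex_figure A v) d = (\<lambda>h. (fst h, 0)) ` {h\<in>active A v. fst h \<bullet> d = 0}
      \<union> {(exposer A v, 1), (- exposer A v, - 1)}"
    using assms unfolding mem_hpoly_vertex_figure active_def[of "vertex_figure A v"] by (auto simp: vertex_figure_def)
  then show ?thesis by (auto simp: lin_def)
qed

text \<open>Subtracting the multiple of \<open>d\<close> makes \<open>e\<close> parallel to the
  slice, where the exposing functional takes the value 1 on \<open>d\<close>. Face directions at
  \<open>x\<close> are thus face directions of the figure modulo \<open>d\<close>.\<close>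

lemma lin_vertex_figure_project:
  assumes "d \<in> hpoly (vertex_figure A v)" "active A x \<supseteq> {h\<in>active A v. fst h \<bullet> d = 0}" "e \<in> lin A x"
  shows "e - (exposer A v \<bullet> e) *\<^sub>R d \<in> lin (vertex_figure A v) d"
  using assms unfolding lin_vertex_figure[OF assms(1)]
  by (fastforce simp: mem_hpoly_vertex_figure inner_diff_right lin_def)

text \<open>Central projection from \<open>v\<close> onto the vertex figure.\<close>

definition direction :: "('a::euclidean_space \<times> real) set \<Rightarrow> 'a \<Rightarrow> 'a \<Rightarrow> 'a" where
  "direction A v x = (1 / (exposer A v \<bullet> (x - v))) *\<^sub>R (x - v)"

lemma direction:
  assumes "finite A" "v \<in> vertices (hpoly A)" "x \<in> hpoly A" "x \<noteq> v"
  shows "exposer A v \<bullet> (x - v) > 0"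
    and "x = v + (exposer A v \<bullet> (x - v)) *\<^sub>R direction A v x"
    and "direction A v x \<in> hpoly (vertex_figure A v)"
proof -
  show pos: "exposer A v \<bullet> (x - v) > 0"
    using exposer_unique[OF assms(1-3)] assms(4) by (force simp: inner_diff_right)
  then show "x = v + (exposer A v \<bullet> (x - v)) *\<^sub>R direction A v x"
    by (simp add: direction_def)
  show "direction A v x \<in> hpoly (vertex_figure A v)"
    using pos assms(3) unfolding mem_hpoly_vertex_figure direction_def
    by (auto simp: inner_diff_right active_def hpoly_def)
qed

text \<open>A point slightly beyond \<open>v\<close> along \<open>p\<close> has a smallest face
  contained in the line through \<open>v\<close> along \<open>p\<close>. As \<open>p\<close> is not
  a recession direction, some inequality stops the ray, and the stopping point is the other end of
  the edge.\<close>

lemma edge_along: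
  assumes A: "finite A" and v: "v \<in> vertices (hpoly A)"
    and p: "p \<in> vertices (hpoly (vertex_figure A v))" "p \<notin> hrec A"
  obtains u s where "0 < s" "u = v + s *\<^sub>R p" "closed_segment v u \<in> compact_edges (hpoly A)"
proof -
  have vP: "v \<in> hpoly A" using v vertices_subset by blast
  have pF: "p \<in> hpoly (vertex_figure A v)" and lp: "lin (vertex_figure A v) p = {0}"
    using p(1) by (auto simp: vertices_hpoly_iff finite_vertex_figure A)
  have pK: "\<forall>h\<in>active A v. 0 \<le> fst h \<bullet> p" using pF by (simp add: mem_hpoly_vertex_figure)
  obtain s where s: "0 \<le> s" "v + s *\<^sub>R p \<in> hpoly A" "\<exists>h\<in>active A (v + s *\<^sub>R p). fst h \<bullet> p < 0"
    using ray_exit[OF A vP p(2)] .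
  then have s0: "0 < s" using pK by (cases "s = 0") force+
  define u where "u = v + s *\<^sub>R p"
  obtain h where h: "h \<in> active A u" "fst h \<bullet> p < 0" using s(3) u_def by blast
  obtain e where e: "0 < e" "v + e *\<^sub>R p \<in> hpoly A"
    "active A (v + e *\<^sub>R p) = {h\<in>active A v. fst h \<bullet> p = 0}"
    using nudge[OF A vP pK] .
  let ?x = "v + e *\<^sub>R p"
  have p0: "p \<noteq> 0" using pF by (auto simp: mem_hpoly_vertex_figure)
  have "act_face A ?x = closed_segment v u"
  proof
    have "v \<in> act_face A ?x" "u \<in> act_face A ?x"
      using vP s(2) e(3) by (auto simp: act_face_def u_def active_def inner_add_right)
    then show "closed_segment v u \<subseteq> act_face A ?x"
      by (intro closed_segment_subset face_of_imp_convex[OF act_face_face_of])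
    show "act_face A ?x \<subseteq> closed_segment v u"
    proof
      fix y assume y: "y \<in> act_face A ?x"
      then have "y \<in> hpoly A" "y - ?x \<in> lin A ?x" using mem_act_face_iff[OF e(2)] by auto
      \<comment> \<open>The vertex \<open>p\<close> has no face directions in the figure, so only
        multiples of \<open>p\<close> remain.\<close>
      then have "y - ?x - (exposer A v \<bullet> (y - ?x)) *\<^sub>R p = 0"
        using lin_vertex_figure_project[OF pF, of ?x] e(3) lp by fastforce
      then have yeq: "y = v + (exposer A v \<bullet> (y - v)) *\<^sub>R p"
        using pF by (simp add: mem_hpoly_vertex_figure algebra_simps)
      define m where "m = exposer A v \<bullet> (y - v)"
      have m0: "0 \<le> m" using exposer_min[OF \<open>y \<in> hpoly A\<close>, of v] by (simp add: m_def inner_diff_right)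
      have "snd h \<le> fst h \<bullet> v + m * (fst h \<bullet> p)"
        using h(1) \<open>y \<in> hpoly A\<close> yeq
        by (auto simp: active_def hpoly_def m_def) (metis fst_conv inner_add_right inner_scaleR_right snd_conv)
      moreover have "snd h = fst h \<bullet> v + s * (fst h \<bullet> p)"
        using h(1) by (auto simp: active_def u_def inner_add_right)
      ultimately have "m \<le> s" using h(2) by auto
      have "y = v + m *\<^sub>R p" using yeq by (simp add: m_def)
      also have "\<dots> = (1 - m / s) *\<^sub>R v + (m / s) *\<^sub>R u"
        using s0 by (simp add: u_def algebra_simps)
      finally have "y = (1 - m / s) *\<^sub>R v + (m / s) *\<^sub>R u" .
      then show "y \<in> closed_segment v u"
        using m0 \<open>m \<le> s\<close> s0 unfolding in_segment by (intro exI[of _ "m / s"]) auto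
    qed
  qed
  then have "closed_segment v u face_of hpoly A" using act_face_face_of[of A ?x] by simp
  moreover have "aff_dim (closed_segment v u) = 1"
    using p0 s0 aff_dim_2[of v u] by (simp add: segment_convex_hull aff_dim_convex_hull u_def)
  ultimately show thesis
    using that[OF s0 u_def] by (simp add: compact_edges_def edge_of_def)
qed

text \<open>A face direction of the figure at the projected point is a face direction at the
  midpoint of the edge, hence a multiple of \<open>u - v\<close>. The exposing functional kills the
  former but not \<open>u - v\<close>.\<close>

lemma edge_direction_vertex:
  assumes A: "finite A" and e: "closed_segment v u \<in> compact_edges (hpoly A)"
  shows "direction A v u \<in> vertices (hpoly (vertex_figure A v))"
proof -
  have v: "v \<in> vertices (hpoly A)" "u \<in> vertices (hpoly A)" "v \<noteq> u"
    using compact_edge_vertices[OF e] .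
  then have uP: "u \<in> hpoly A" and vP: "v \<in> hpoly A" using vertices_subset by auto
  note dir = direction[OF A v(1) uP v(3)[symmetric]]
  let ?p = "direction A v u"
  have face: "closed_segment v u face_of hpoly A" using e by (simp add: compact_edges_def edge_of_def)
  have "f = 0" if f: "f \<in> lin (vertex_figure A v) ?p" for f
  proof -
    have f1: "exposer A v \<bullet> f = 0" "\<And>h. h \<in> active A v \<Longrightarrow> fst h \<bullet> ?p = 0 \<Longrightarrow> fst h \<bullet> f = 0"
      using f lin_vertex_figure[OF dir(3)] by auto
    have "active A (midpoint v u) \<subseteq> active A v \<inter> active A u"
      using v(3) by (intro active_open_segment vP uP) simp
    then have "f \<in> lin A (midpoint v u)"
      using f1(2) by (fastforce simp: lin_def active_def direction_def inner_diff_right)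
    then obtain k where "f = k *\<^sub>R (u - v)" using segment_face_lin[OF A face] by blast
    then show "f = 0" using f1(1) dir(1) by auto
  qed
  then show ?thesis
    using dir(3) subspace_0[OF subspace_lin] by (auto simp: vertices_hpoly_iff finite_vertex_figure A)
qed

lemma edge_direction_unique:
  assumes A: "finite A" and e: "closed_segment v u \<in> compact_edges (hpoly A)"
    "closed_segment v u' \<in> compact_edges (hpoly A)" and eq: "direction A v u = direction A v u'"
  shows "u = u'"
proof -
  note V = compact_edge_vertices[OF e(1)] compact_edge_vertices[OF e(2)]
  have P: "v \<in> hpoly A" "u \<in> hpoly A" "u' \<in> hpoly A" using V vertices_subset by auto
  let ?p = "direction A v u"
  \<comment> \<open>Of two points on one ray from \<open>v\<close>, the nearer lies strictly between
    \<open>v\<close> and the farther and cannot be a vertex.\<close>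
  have *: "\<not> a < b" if ab: "0 < a" "v + a *\<^sub>R ?p \<in> vertices (hpoly A)" "v + b *\<^sub>R ?p \<in> hpoly A"
    "?p \<noteq> 0" for a b
  proof
    assume "a < b"
    have "v + a *\<^sub>R ?p = (1 - a / b) *\<^sub>R v + (a / b) *\<^sub>R (v + b *\<^sub>R ?p)"
      using \<open>a < b\<close> ab(1) by (simp add: algebra_simps)
    then have "v + a *\<^sub>R ?p \<in> open_segment v (v + b *\<^sub>R ?p)"
      using \<open>a < b\<close> ab(1,4) unfolding in_segment by (intro conjI exI[of _ "a / b"]) auto
    then show False using ab(2,3) P(1) by (auto simp: vertices_def extreme_point_of_def)
  qed
  note d = direction[OF A V(1) P(2) V(3)[symmetric]] and d' = direction[OF A V(1) P(3) V(6)[symmetric]]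
  have "?p \<noteq> 0" using d(3) by (auto simp: mem_hpoly_vertex_figure)
  then have "exposer A v \<bullet> (u - v) = exposer A v \<bullet> (u' - v)"
    using *[of "exposer A v \<bullet> (u - v)" "exposer A v \<bullet> (u' - v)"]
      *[of "exposer A v \<bullet> (u' - v)" "exposer A v \<bullet> (u - v)"]
      d(1,2) d'(1,2) V P eq by (metis linorder_neqE)
  then show ?thesis using d(2) d'(2) eq by metis
qed

section \<open>Descent along compact edges\<close>

lemma direction_along:
  assumes "0 < s" "p \<in> hpoly (vertex_figure A v)"
  shows "direction A v (v + s *\<^sub>R p) = p"
  using assms by (simp add: direction_def mem_hpoly_vertex_figure)

text \<open>The step of the simplex method. The figure is the hull of its vertices, so
  \<open>c\<close> is negative at one of them; as \<open>c\<close> is nonnegative on the recession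
  cone, the edge in that direction is compact.\<close>

lemma lower_neighbour:
  assumes A: "finite A" and v: "v \<in> vertices (hpoly A)" and c: "\<And>a. a \<in> hrec A \<Longrightarrow> 0 \<le> c \<bullet> a"
    and x: "x \<in> hpoly A" "c \<bullet> x < c \<bullet> v"
  obtains u where "closed_segment v u \<in> compact_edges (hpoly A)" "c \<bullet> u < c \<bullet> v"
proof -
  have xv: "x \<noteq> v" using x by auto
  note d = direction[OF A v x(1) xv]
  have "c \<bullet> direction A v x < 0"
    using d(1) x(2) by (simp add: direction_def inner_diff_right divide_less_0_iff)
  moreover have "direction A v x \<in> convex hull (vertices (hpoly (vertex_figure A v)))"
    using hpoly_decomposition[OF finite_vertex_figure[OF A] pointed_vertex_figure[OF A v] d(3)]
    by (simp add: hrec_vertex_figure[OF A v])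
  ultimately obtain p where p: "p \<in> vertices (hpoly (vertex_figure A v))" "c \<bullet> p < 0"
    using hull_halfspace_ge[of "vertices (hpoly (vertex_figure A v))" 0 c] by force
  then have "p \<notin> hrec A" using c by force
  then obtain u s where u: "0 < s" "u = v + s *\<^sub>R p" "closed_segment v u \<in> compact_edges (hpoly A)"
    using edge_along[OF A v p(1)] by blast
  then have "c \<bullet> u < c \<bullet> v" using p(2) by (simp add: inner_add_right mult_pos_neg)
  with u(3) that show thesis by blast
qed

text \<open>Induction on the number of vertices strictly below \<open>v\<close>. Connectedness of
  the edge graph and all comparisons of potentials are instances.\<close>

lemma descent_induct:
  assumes A: "finite A" and w: "w \<in> vertices (hpoly A)" and c: "\<And>a. a \<in> hrec A \<Longrightarrow> 0 \<le> c \<bullet> a"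
    and min: "\<And>x. x \<in> vertices (hpoly A) \<Longrightarrow> c \<bullet> x \<le> c \<bullet> w \<Longrightarrow> x = w"
    and base: "Q w"
    and step: "\<And>v u. closed_segment v u \<in> compact_edges (hpoly A) \<Longrightarrow> c \<bullet> u < c \<bullet> v \<Longrightarrow> Q u \<Longrightarrow> Q v"
    and "v \<in> vertices (hpoly A)"
  shows "Q v"
  using assms(7)
proof (induction "card {x \<in> vertices (hpoly A). c \<bullet> x < c \<bullet> v}" arbitrary: v rule: less_induct)
  case less
  show ?case
  proof (cases "v = w")
    case False
    then have "c \<bullet> w < c \<bullet> v" using min[OF less.prems] by force
    moreover have "w \<in> hpoly A" using w vertices_subset by blast
    ultimately obtain u where u: "closed_segment v u \<in> compact_edges (hpoly A)" "c \<bullet> u < c \<bullet> v"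
      using lower_neighbour[OF A less.prems c] by blast
    have uV: "u \<in> vertices (hpoly A)" using compact_edge_vertices[OF u(1)] by blast
    have "{x \<in> vertices (hpoly A). c \<bullet> x < c \<bullet> u} \<subset> {x \<in> vertices (hpoly A). c \<bullet> x < c \<bullet> v}"
      using u(2) uV by auto
    then have "Q u"
      using less.hyps[OF psubset_card_mono uV] finite_vertices[OF A] by simp
    then show ?thesis using step u by blast
  qed (use base in simp)
qed

text \<open>With a negative coefficient at \<open>q\<close>, the extreme point \<open>p\<close>
  would lie strictly between \<open>g\<close> and \<open>q\<close>.\<close>

lemma extreme_line_contradiction:
  assumes "p \<in> vertices S" "g \<in> S" "q \<in> S" "p \<noteq> q" "g = a *\<^sub>R p + b *\<^sub>R q" "a + b = 1"
  shows "0 \<le> b"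
proof (rule ccontr)
  assume "\<not> 0 \<le> b"
  then have b: "b < 0" and a: "a > 1" using assms(6) by auto
  have gq: "g \<noteq> q"
  proof
    assume "g = q"
    then have "a *\<^sub>R p + (b - 1) *\<^sub>R q = 0" using assms(5) by (simp add: algebra_simps)
    moreover have "b - 1 = - a" using assms(6) by simp
    ultimately have "a *\<^sub>R (p - q) = 0" by (simp add: algebra_simps)
    then show False using a assms(4) by simp
  qed
  \<comment> \<open>Solving \<open>g = a p + b q\<close> for \<open>p\<close> gives the weights
    \<open>1 / a\<close> and \<open>- b / a\<close>, which add up to 1.\<close>
  have "(1 - (- b / a)) *\<^sub>R g + (- b / a) *\<^sub>R q = ((a + b) / a * a) *\<^sub>R p + ((a + b) / a * b + (- b / a)) *\<^sub>R q"
    using a unfolding assms(5) by (simp add: algebra_simps add_divide_distrib)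
  moreover have "(a + b) / a * a = 1" "(a + b) / a * b + (- b / a) = 0"
    using a assms(6) by simp_all
  ultimately have "p = (1 - (- b / a)) *\<^sub>R g + (- b / a) *\<^sub>R q" by (metis add.right_neutral scaleR_one scaleR_zero_left)
  moreover have "0 < - b / a" "- b / a < 1" using a b assms(6) by (auto simp: field_simps)
  ultimately have "p \<in> open_segment g q"
    using gq unfolding in_segment by blast
  then show False using assms(1-3) by (auto simp: vertices_def extreme_point_of_def)
qed

text \<open>The edge \<open>[p, q]\<close> of the figure spans a two-dimensional cone at
  \<open>v\<close>, in which the face of the polyhedron lies. As \<open>c\<close> decreases along
  both generators and is bounded below, the face is bounded with \<open>v\<close> as its only
  highest point.\<close>

lemma vertex_figure_edge_2face:
  assumes A: "finite A" and v: "v \<in> vertices (hpoly A)" and c: "\<And>a. a \<in> hrec A \<Longrightarrow> 0 \<le> c \<bullet> a"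
    and pq: "closed_segment p q \<in> compact_edges (hpoly (vertex_figure A v))" "c \<bullet> p < 0" "c \<bullet> q < 0"
    and u: "closed_segment v u \<in> compact_edges (hpoly A)" "direction A v u = p"
    and u': "closed_segment v u' \<in> compact_edges (hpoly A)" "direction A v u' = q"
  obtains F where "F \<in> compact_2faces (hpoly A)" "closed_segment v u edge_of F"
    "closed_segment v u' edge_of F" "\<And>x. x \<in> F \<Longrightarrow> x \<noteq> v \<Longrightarrow> c \<bullet> x < c \<bullet> v"
proof -
  let ?B = "vertex_figure A v" and ?c = "exposer A v" and ?d = "midpoint p q"
  have B: "finite ?B" using A by (rule finite_vertex_figure)
  note pqV = compact_edge_vertices[OF pq(1)]
  have vP: "v \<in> hpoly A" using v vertices_subset by blast
  have pF: "p \<in> hpoly ?B" and qF: "q \<in> hpoly ?B" using pqV vertices_subset by auto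
  have cp: "?c \<bullet> p = 1" and cq: "?c \<bullet> q = 1" using pF qF by (auto simp: mem_hpoly_vertex_figure)
  have pqface: "closed_segment p q face_of hpoly ?B" using pq(1) by (simp add: compact_edges_def edge_of_def)
  have dF: "?d \<in> hpoly ?B" using face_of_imp_subset[OF pqface] midpoint_in_closed_segment by blast
  have dd: "?d = (1/2) *\<^sub>R p + (1/2) *\<^sub>R q"
    unfolding midpoint_def inverse_eq_divide scaleR_add_right ..
  have "\<forall>h\<in>active A v. 0 \<le> fst h \<bullet> ?d" using dF by (simp add: mem_hpoly_vertex_figure)
  then obtain e where e: "0 < e" "v + e *\<^sub>R ?d \<in> hpoly A"
    "active A (v + e *\<^sub>R ?d) = {h\<in>active A v. fst h \<bullet> ?d = 0}"
    using nudge[OF A vP] by blast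
  \<comment> \<open>A point just beyond \<open>v\<close> in the direction of the midpoint of the
    figure's edge; its smallest face is the required 2-face.\<close>
  define x where "x = v + e *\<^sub>R ?d"
  define F where "F = act_face A x"
  have act: "active A x = {h\<in>active A v. fst h \<bullet> ?d = 0}" using e(3) x_def by simp
  have act_pq: "h \<in> active A v \<and> fst h \<bullet> p = 0 \<and> fst h \<bullet> q = 0" if "h \<in> active A x" for h
  proof -
    have "0 \<le> fst h \<bullet> p" "0 \<le> fst h \<bullet> q" using that act pF qF by (auto simp: mem_hpoly_vertex_figure)
    moreover have "fst h \<bullet> p + fst h \<bullet> q = 0" using that act by (simp add: dd inner_add_right)
    ultimately show ?thesis using that act by auto
  qed
  have pqspan: "p \<in> span {p, q}" "q \<in> span {p, q}" "?d \<in> span {p, q}"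
    unfolding dd by (simp_all add: span_add span_scale span_base)
  have lin: "lin A x = span {p, q}"
  proof
    have "p \<in> lin A x" "q \<in> lin A x" using act_pq by (auto simp: lin_def)
    then show "span {p, q} \<subseteq> lin A x" by (intro span_minimal subspace_lin) auto
    show "lin A x \<subseteq> span {p, q}"
    proof
      fix f assume "f \<in> lin A x"
      then have "f - (?c \<bullet> f) *\<^sub>R ?d \<in> lin ?B ?d"
        using lin_vertex_figure_project[OF dF, of x f] act by blast
      then obtain k where "f - (?c \<bullet> f) *\<^sub>R ?d = k *\<^sub>R (q - p)"
        using segment_face_lin[OF B pqface] by blast
      then have "f = (?c \<bullet> f) *\<^sub>R ?d + k *\<^sub>R (q - p)" by (simp add: algebra_simps)
      also have "\<dots> \<in> span {p, q}" using pqspan by (intro span_add span_scale span_diff)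
      finally show "f \<in> span {p, q}" .
    qed
  qed
  have "independent {p, q}"
  proof -
    have "p \<notin> span {q}"
    proof
      assume "p \<in> span {q}"
      then obtain k where "p = k *\<^sub>R q" by (auto simp: span_singleton)
      with cp cq pqV(3) show False by auto
    qed
    moreover have "q \<noteq> 0" using cq by auto
    ultimately show ?thesis using pqV(3) by (simp add: independent_insert)
  qed
  then have "dim (lin A x) = 2"
    using pqV(3) by (simp add: lin dim_eq_card_independent)
  then have dimF: "aff_dim F = 2"
    using aff_dim_act_face[OF A, of x] e(2) by (simp add: F_def x_def)
  have coord: "\<exists>a b. 0 \<le> a \<and> 0 \<le> b \<and> y = v + a *\<^sub>R p + b *\<^sub>R q" if y: "y \<in> F" for y
  proof (cases "y = v")
    case True
    then show ?thesis by (intro exI[of _ 0]) simp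
  next
    case False
    have yP: "y \<in> hpoly A" "y - x \<in> span {p, q}"
      using y mem_act_face_iff[of x A y] e(2) by (auto simp: F_def x_def lin[unfolded x_def])
    have "y - v = (y - x) + e *\<^sub>R ?d" by (simp add: x_def)
    also have "\<dots> \<in> span {p, q}" using yP pqspan by (intro span_add span_scale)
    finally have yv: "y - v \<in> span {p, q}" .
    note d = direction[OF A v yP(1) False]
    have "direction A v y \<in> span {p, q}" unfolding direction_def using yv by (rule span_scale)
    then obtain a b where ab: "direction A v y = a *\<^sub>R p + b *\<^sub>R q"
      by (auto simp: span_insert span_singleton) (metis add.commute diff_add_cancel)
    have "?c \<bullet> direction A v y = 1" using d(3) by (simp add: mem_hpoly_vertex_figure)
    then have sum1: "a + b = 1" using cp cq by (simp add: ab inner_add_right)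
    \<comment> \<open>The projection of \<open>y\<close> lies on the line through \<open>p\<close>
      and \<open>q\<close>, and both are extreme in the figure, so it cannot lie outside the
      segment.\<close>
    have "0 \<le> b" using extreme_line_contradiction[OF pqV(1) d(3) qF pqV(3) ab sum1] .
    moreover have "0 \<le> a"
      using extreme_line_contradiction[OF pqV(2) d(3) pF pqV(3)[symmetric], of b a] ab sum1
      by (simp add: add.commute)
    ultimately show ?thesis
      using d(1,2) ab
      by (intro exI[of _ "?c \<bullet> (y - v) * a"] exI[of _ "?c \<bullet> (y - v) * b"])
         (simp add: scaleR_add_right add.assoc)
  qed
  have low: "c \<bullet> y < c \<bullet> v" if y: "y \<in> F" "y \<noteq> v" for y
  proof -
    obtain a b where ab: "0 \<le> a" "0 \<le> b" "y = v + a *\<^sub>R p + b *\<^sub>R q" using coord[OF y(1)] by blast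
    then have "a > 0 \<or> b > 0" using y(2) by force
    moreover have "a * (c \<bullet> p) \<le> 0" "b * (c \<bullet> q) \<le> 0"
      using ab pq by (auto simp: mult_nonneg_nonpos)
    ultimately have "a * (c \<bullet> p) + b * (c \<bullet> q) < 0"
      using pq mult_pos_neg[of a "c \<bullet> p"] mult_pos_neg[of b "c \<bullet> q"] by argo
    then show ?thesis by (simp add: ab(3) inner_add_right)
  qed
  obtain w where w: "\<And>y. y \<in> hpoly A \<Longrightarrow> c \<bullet> w \<le> c \<bullet> y"
    using vertex_minimum[OF A vertex_pointed[OF A v] _ c] vP by blast
  have FP: "F \<subseteq> hpoly A" unfolding F_def act_face_def by blast
  \<comment> \<open>The largest possible drop of \<open>c\<close> below \<open>v\<close>; it bounds
    both cone coefficients.\<close>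
  let ?C = "c \<bullet> v - c \<bullet> w"
  have "norm y \<le> norm v + ?C / (- (c \<bullet> p)) * norm p + ?C / (- (c \<bullet> q)) * norm q" if y: "y \<in> F" for y
  proof -
    obtain a b where ab: "0 \<le> a" "0 \<le> b" "y = v + a *\<^sub>R p + b *\<^sub>R q" using coord[OF y(1)] by blast
    have "c \<bullet> w \<le> c \<bullet> v + a * (c \<bullet> p) + b * (c \<bullet> q)"
      using w[of y] FP y ab(3) by (auto simp: inner_add_right)
    moreover have "a * (c \<bullet> p) \<le> 0" "b * (c \<bullet> q) \<le> 0"
      using ab pq by (auto simp: mult_nonneg_nonpos)
    ultimately have "a * (- (c \<bullet> p)) \<le> ?C" "b * (- (c \<bullet> q)) \<le> ?C" by auto
    then have le: "a \<le> ?C / (- (c \<bullet> p))" "b \<le> ?C / (- (c \<bullet> q))"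
      using pq by (subst pos_le_divide_eq; simp)+
    have "norm y \<le> norm v + norm (a *\<^sub>R p) + norm (b *\<^sub>R q)"
      unfolding ab(3) by (intro norm_triangle_le add_right_mono norm_triangle_ineq)
    then have "norm y \<le> norm v + a * norm p + b * norm q" using ab by simp
    moreover have "a * norm p \<le> ?C / (- (c \<bullet> p)) * norm p" "b * norm q \<le> ?C / (- (c \<bullet> q)) * norm q"
      using mult_right_mono[OF le(1) norm_ge_zero] mult_right_mono[OF le(2) norm_ge_zero] by blast+
    ultimately show ?thesis by linarith
  qed
  then have "bounded F" unfolding bounded_iff by blast
  then have "compact F" unfolding F_def using closed_act_face compact_eq_bounded_closed by blast
  then have F2: "F \<in> compact_2faces (hpoly A)"
    using dimF act_face_face_of by (auto simp: compact_2faces_def F_def)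
  have vF: "v \<in> F" using vP act by (auto simp: F_def act_face_def)
  have edgeF: "closed_segment v z edge_of F"
    if z: "closed_segment v z \<in> compact_edges (hpoly A)" "direction A v z \<in> {p, q}" for z
  proof -
    have zP: "z \<in> hpoly A" "z \<noteq> v" using compact_edge_vertices[OF z(1)] vertices_subset by auto
    obtain s where s: "z = v + s *\<^sub>R direction A v z" using direction(2)[OF A v zP] by blast
    have "z \<in> F"
      using zP(1) act_pq z(2) unfolding F_def act_face_def
      by (auto simp: active_def) (metis (no_types, lifting) fst_conv inner_add_right inner_scaleR_right mult_zero_right add_0_right s)+
    then have "closed_segment v z \<subseteq> F"
      unfolding F_def using vF[unfolded F_def]
      by (intro closed_segment_subset face_of_imp_convex[OF act_face_face_of])
    then show ?thesis
      using z(1) face_of_subset[OF _ _ FP] by (auto simp: compact_edges_def edge_of_def)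
  qed
  show thesis using that[OF F2 edgeF edgeF low] u u' by auto
qed

text \<open>
  Lower neighbours of \<open>v\<close> are the vertices of the vertex figure in an open half-space. They are joined by
  edges of the figure in that half-space, and these edges span the compact 2-faces with top \<open>v\<close>.
\<close>

lemma lower_neighbours_linked:
  assumes A: "finite A" and v: "v \<in> vertices (hpoly A)" and c: "\<And>a. a \<in> hrec A \<Longrightarrow> 0 \<le> c \<bullet> a"
    and link: "\<And>F u u'. F \<in> compact_2faces (hpoly A) \<Longrightarrow> closed_segment v u edge_of F \<Longrightarrow>
       closed_segment v u' edge_of F \<Longrightarrow> (\<And>x. x \<in> F \<Longrightarrow> x \<noteq> v \<Longrightarrow> c \<bullet> x < c \<bullet> v) \<Longrightarrow> f u = f u'"
    and u: "closed_segment v u \<in> compact_edges (hpoly A)" "c \<bullet> u < c \<bullet> v"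
    and u': "closed_segment v u' \<in> compact_edges (hpoly A)" "c \<bullet> u' < c \<bullet> v"
  shows "f u = f u'"
proof -
  let ?B = "vertex_figure A v"
  have B: "finite ?B" using A by (rule finite_vertex_figure)
  have dir_neg: "c \<bullet> direction A v z < 0"
    if z: "closed_segment v z \<in> compact_edges (hpoly A)" "c \<bullet> z < c \<bullet> v" for z
  proof -
    have zP: "z \<in> hpoly A" "z \<noteq> v" using compact_edge_vertices[OF z(1)] vertices_subset by auto
    show ?thesis
      using direction(1)[OF A v zP] z(2) by (simp add: direction_def inner_diff_right divide_less_0_iff)
  qed
  have along: "\<exists>z. closed_segment v z \<in> compact_edges (hpoly A) \<and> direction A v z = p"
    if p: "p \<in> vertices (hpoly ?B)" "c \<bullet> p < 0" for p
  proof -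
    have "p \<notin> hrec A" using c p(2) by force
    then obtain z s where "0 < s" "z = v + s *\<^sub>R p" "closed_segment v z \<in> compact_edges (hpoly A)"
      using edge_along[OF A v p(1)] by blast
    then show ?thesis using direction_along p(1) vertices_subset by blast
  qed
  have duV: "direction A v u \<in> vertices (hpoly ?B)" using edge_direction_vertex[OF A u(1)] .
  then have "hpoly ?B \<noteq> {}" using vertices_subset by blast
  \<comment> \<open>A lowest vertex of the figure serves as common target: every lower neighbour is
    compared with the one in direction \<open>m\<close>.\<close>
  then obtain m where m: "m \<in> vertices (hpoly ?B)" "\<And>z. z \<in> hpoly ?B \<Longrightarrow> c \<bullet> m \<le> c \<bullet> z"
    using vertex_minimum[OF B pointed_vertex_figure[OF A v], of c] hrec_vertex_figure[OF A v] by auto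
  have "c \<bullet> m < 0" using m(2)[of "direction A v u"] duV vertices_subset dir_neg[OF u] by fastforce
  then obtain um where um: "closed_segment v um \<in> compact_edges (hpoly A)" "direction A v um = m"
    using along[OF m(1)] by blast
  have "f z = f um" if z: "closed_segment v z \<in> compact_edges (hpoly A)" "c \<bullet> z < c \<bullet> v" for z
  proof -
    let ?e = "exposer ?B m" and ?p = "direction A v z"
    have pV: "?p \<in> vertices (hpoly ?B)" using edge_direction_vertex[OF A z(1)] .
    then have pF: "?p \<in> hpoly ?B" using vertices_subset by blast
    define K where "K = ?e \<bullet> ?p - ?e \<bullet> m"
    have K: "0 \<le> K" unfolding K_def using exposer_min[OF pF] by simp
    \<comment> \<open>Chosen so that the perturbed functional takes the value
      \<open>(c \<bullet> ?p) / (K + 1)\<close> at \<open>?p\<close>, which is still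
      negative.\<close>
    define r where "r = (- (c \<bullet> ?p)) / (K + 1)"
    have r: "0 < r" unfolding r_def using K dir_neg[OF z] by (intro divide_pos_pos) auto
    \<comment> \<open>On the figure \<open>exposer A v\<close> is constantly 1, so the subtracted
      multiple makes the perturbation vanish at \<open>m\<close> and nonnegative elsewhere. Thus
      \<open>m\<close> is the unique minimum of \<open>g\<close>.\<close>
    define g where "g = c + r *\<^sub>R (?e - (?e \<bullet> m) *\<^sub>R exposer A v)"
    have g: "g \<bullet> y = c \<bullet> y + r * (?e \<bullet> y - ?e \<bullet> m)" if "y \<in> hpoly ?B" for y
      using that by (simp add: g_def mem_hpoly_vertex_figure inner_add_left inner_diff_left)
    have ge: "c \<bullet> y \<le> g \<bullet> y" if "y \<in> hpoly ?B" for y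
      using g[OF that] r exposer_min[OF that, of m] by simp
    have "g \<bullet> ?p = (c \<bullet> ?p) / (K + 1)"
      using g[OF pF] K unfolding r_def K_def[symmetric] by (simp add: field_simps)
    then have gp: "g \<bullet> ?p < 0" using divide_neg_pos[OF dir_neg[OF z], of "K + 1"] K by linarith
    \<comment> \<open>Since \<open>c \<le> g\<close> on the figure, a descent that starts with
      \<open>g\<close> negative never leaves the half-space where \<open>c\<close> is
      negative.\<close>
    define Q where "Q y \<longleftrightarrow> (g \<bullet> y < 0 \<longrightarrow> (\<forall>z. closed_segment v z \<in> compact_edges (hpoly A) \<longrightarrow>
      direction A v z = y \<longrightarrow> f z = f um))" for y
    have "Q ?p"
    proof (rule descent_induct[OF B m(1), of g])
      show "0 \<le> g \<bullet> a" if "a \<in> hrec ?B" for a using that hrec_vertex_figure[OF A v] by simp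
      show "y = m" if y: "y \<in> vertices (hpoly ?B)" "g \<bullet> y \<le> g \<bullet> m" for y
      proof -
        have yF: "y \<in> hpoly ?B" and mF: "m \<in> hpoly ?B" using y m vertices_subset by auto
        have "r * (?e \<bullet> y - ?e \<bullet> m) \<le> 0" using y(2) g[OF yF] g[OF mF] m(2)[OF yF] by simp
        then have "?e \<bullet> y \<le> ?e \<bullet> m" using r by (simp add: mult_le_0_iff)
        then show ?thesis using exposer_unique[OF B m(1) yF] by simp
      qed
      show "Q m" unfolding Q_def using edge_direction_unique[OF A _ um(1)] um(2) by metis
      show "Q y" if y: "closed_segment y y' \<in> compact_edges (hpoly ?B)" "g \<bullet> y' < g \<bullet> y" "Q y'" for y y'
        unfolding Q_def
      proof (intro impI allI)
        fix z assume gy: "g \<bullet> y < 0" and z: "closed_segment v z \<in> compact_edges (hpoly A)" "direction A v z = y"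
        note yV = compact_edge_vertices[OF y(1)]
        have "y \<in> hpoly ?B" "y' \<in> hpoly ?B" using yV vertices_subset by auto
        then have cy: "c \<bullet> y < 0" "c \<bullet> y' < 0" using ge gy y(2) by fastforce+
        obtain z' where z': "closed_segment v z' \<in> compact_edges (hpoly A)" "direction A v z' = y'"
          using along[OF yV(2) cy(2)] by blast
        have "f z' = f um" using y(2,3) gy z' unfolding Q_def by simp
        moreover obtain F where "F \<in> compact_2faces (hpoly A)" "closed_segment v z edge_of F"
          "closed_segment v z' edge_of F" "\<And>x. x \<in> F \<Longrightarrow> x \<noteq> v \<Longrightarrow> c \<bullet> x < c \<bullet> v"
          using vertex_figure_edge_2face[OF A v c y(1) cy z z'] by blast
        then have "f z = f z'" using link by blast
        ultimately show "f z = f um" by simp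
      qed
    qed (use pV in auto)
    then show ?thesis using gp z unfolding Q_def by blast
  qed
  then show ?thesis using u u' by metis
qed

section \<open>Potentials on the graph of compact edges\<close>

lemma Suc_mod_inj:
  assumes "i < n" "j < n" "Suc i mod n = Suc j mod n"
  shows "i = j"
  using assms by (cases "Suc i = n"; cases "Suc j = n") auto

lemma cyclic_sum_diff:
  fixes G :: "nat \<Rightarrow> 'b::ab_group_add"
  shows "(\<Sum>j<n. G (Suc j mod n) - G j) = 0"
proof (cases n)
  case (Suc m)
  have "(\<Sum>j<n. G (Suc j mod n)) = (\<Sum>j<m. G (Suc j)) + G 0"
    by (simp add: Suc)
  also have "\<dots> = (\<Sum>j<n. G j)"
    unfolding Suc sum.lessThan_Suc_shift by (simp add: add.commute)
  finally show ?thesis by (simp add: sum_subtractf)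
qed simp

text \<open>Both sums around the cycle vanish, so agreement in all terms but one forces agreement in
  the last.\<close>

lemma cyclic_sum_last:
  fixes f G :: "nat \<Rightarrow> 'b::ab_group_add"
  assumes "i < n" "(\<Sum>j<n. f j) = 0" "\<And>j. j < n \<Longrightarrow> j \<noteq> i \<Longrightarrow> f j = G (Suc j mod n) - G j"
  shows "f i = G (Suc i mod n) - G i"
proof -
  let ?D = "\<lambda>j. G (Suc j mod n) - G j"
  have "(\<Sum>j<n. f j) = f i + (\<Sum>j\<in>{..<n} - {i}. f j)"
    "(\<Sum>j<n. ?D j) = ?D i + (\<Sum>j\<in>{..<n} - {i}. ?D j)"
    using assms(1) by (simp_all add: sum.remove)
  moreover have "(\<Sum>j\<in>{..<n} - {i}. f j) = (\<Sum>j\<in>{..<n} - {i}. ?D j)"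
    using assms(3) by (intro sum.cong) auto
  ultimately show ?thesis using assms(2) cyclic_sum_diff[of G n]
    by (metis add_right_cancel)
qed

text \<open>Closing up is one vector equation around \<open>F\<close>; once every other edge carries
  the right difference, it yields the one at \<open>closed_segment v u'\<close>.\<close>

lemma potential_on_2face:
  fixes g :: "'a::euclidean_space \<Rightarrow> 'a"
  assumes cl: "closes_up t F"
    and u: "closed_segment v u edge_of F" and u': "closed_segment v u' edge_of F" and "u \<noteq> u'"
    and far: "\<And>a b. closed_segment a b edge_of F \<Longrightarrow> a \<noteq> v \<Longrightarrow> b \<noteq> v \<Longrightarrow>
        g b - g a = t (closed_segment a b) *\<^sub>R (b - a)"
    and near: "g u - g v = t (closed_segment v u) *\<^sub>R (u - v)"
  shows "g u' - g v = t (closed_segment v u') *\<^sub>R (u' - v)"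
proof -
  obtain us where us: "boundary_cycle F us"
    and sum0: "(\<Sum>j<length us. t (closed_segment (us ! j) (us ! (Suc j mod length us))) *\<^sub>R
             (us ! (Suc j mod length us) - us ! j)) = 0"
    using cl unfolding closes_up_def by blast
  let ?n = "length us"
  define e where "e j = closed_segment (us ! j) (us ! (Suc j mod ?n))" for j
  have dist: "distinct us" and edges: "{d. d edge_of F} = {e j | j. j < ?n}"
    using us by (auto simp: boundary_cycle_def e_def)
  have e_edge: "e j edge_of F" if "j < ?n" for j using edges that by blast
  obtain j0 where j0: "j0 < ?n" "closed_segment v u' = e j0" using edges u' by blast
  obtain j1 where j1: "j1 < ?n" "closed_segment v u = e j1" using edges u by blast
  have "closed_segment v u \<noteq> closed_segment v u'" using \<open>u \<noteq> u'\<close> by (auto simp: doubleton_eq_iff)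
  then have "j0 \<noteq> j1" using j0(2) j1(2) by auto
  have at_v: "us ! j0 = v \<or> us ! (Suc j0 mod ?n) = v" "us ! j1 = v \<or> us ! (Suc j1 mod ?n) = v"
    using j0(2) j1(2) by (auto simp: e_def doubleton_eq_iff)
  have inj1: "i = j" if "i < ?n" "j < ?n" "us ! i = us ! j" for i j
    using that dist nth_eq_iff_index_eq by blast
  have inj2: "i = j" if "i < ?n" "j < ?n" "us ! (Suc i mod ?n) = us ! (Suc j mod ?n)" for i j
  proof -
    have "0 < ?n" using that by linarith
    then have "Suc i mod ?n = Suc j mod ?n" using that(3) inj1 by simp
    then show ?thesis using Suc_mod_inj that by blast
  qed
  \<comment> \<open>In a cyclic enumeration without repetition, \<open>v\<close> starts one edge and
    ends one edge; these are \<open>j0\<close> and \<open>j1\<close>.\<close>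
  have away: "us ! j \<noteq> v \<and> us ! (Suc j mod ?n) \<noteq> v" if j: "j < ?n" "j \<noteq> j0" "j \<noteq> j1" for j
    using at_v inj1 inj2 j j0(1) j1(1) \<open>j0 \<noteq> j1\<close> by metis
  \<comment> \<open>Both sides change sign when an edge is traversed backwards, so the orientation
    of the enumeration is immaterial.\<close>
  have ends: "g (us ! (Suc j mod ?n)) - g (us ! j) = t (e j) *\<^sub>R (us ! (Suc j mod ?n) - us ! j)
      \<longleftrightarrow> g z - g v = t (closed_segment v z) *\<^sub>R (z - v)" if "closed_segment v z = e j" for z j
  proof -
    from that consider "us ! j = v" "us ! (Suc j mod ?n) = z" | "us ! j = z" "us ! (Suc j mod ?n) = v"
      by (auto simp: e_def doubleton_eq_iff)
    then show ?thesis
    proof cases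
      case 2
      have "g v - g z = t (e j) *\<^sub>R (v - z) \<longleftrightarrow> - (g v - g z) = - (t (e j) *\<^sub>R (v - z))"
        by (simp only: neg_equal_iff_equal)
      then show ?thesis using that 2 by (simp add: algebra_simps)
    qed (use that in simp)
  qed
  have "t (e j) *\<^sub>R (us ! (Suc j mod ?n) - us ! j) = g (us ! (Suc j mod ?n)) - g (us ! j)"
    if j: "j < ?n" "j \<noteq> j0" for j
  proof (cases "j = j1")
    case True
    then show ?thesis using ends[OF j1(2)] near by simp
  next
    case False
    then show ?thesis using far e_edge[OF j(1)] away[OF j False] by (simp add: e_def)
  qed
  then have "t (e j0) *\<^sub>R (us ! (Suc j0 mod ?n) - us ! j0) = g (us ! (Suc j0 mod ?n)) - g (us ! j0)"
    by (intro cyclic_sum_last[OF j0(1), of _ "\<lambda>j. g (us ! j)"]) (use sum0 e_def in auto)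
  then show ?thesis using ends[OF j0(2)] by simp
qed

text \<open>\<open>exposer A v\<close> is at least some \<open>r > 0\<close> on unit recession
  vectors, so a ball around it is nonnegative on the cone. Functionals with a tie between two
  vertices fill finitely many hyperplanes, which cannot cover the ball.\<close>

lemma generic_functional:
  assumes A: "finite A" and v: "v \<in> vertices (hpoly A)"
  obtains c where "\<And>a. a \<in> hrec A \<Longrightarrow> 0 \<le> c \<bullet> a" "inj_on (\<lambda>x. c \<bullet> x) (vertices (hpoly A))"
proof -
  let ?c = "exposer A v" and ?S = "hrec A \<inter> sphere 0 1" and ?V = "vertices (hpoly A)"
  have "closed (hrec A)" using polyhedron_hrec[OF A] polyhedron_imp_closed by blast
  then have S: "compact ?S" by (intro closed_Int_compact compact_sphere)
  \<comment> \<open>Without nonzero recession vectors any radius will do, here 1; otherwise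
    compactness provides a positive minimum.\<close>
  obtain r where r: "0 < r" "\<And>a. a \<in> ?S \<Longrightarrow> r \<le> ?c \<bullet> a"
  proof (cases "?S = {}")
    case True
    then show thesis using that[of 1] by auto
  next
    case False
    have "continuous_on ?S (\<lambda>a. ?c \<bullet> a)" by (intro continuous_intros)
    then obtain b where b: "b \<in> ?S" "\<And>a. a \<in> ?S \<Longrightarrow> ?c \<bullet> b \<le> ?c \<bullet> a"
      using continuous_attains_inf[OF S False] by blast
    have "0 < ?c \<bullet> b" using exposer_hrec_pos[OF A v, of b] b(1) by force
    then show thesis using that b(2) by blast
  qed
  have nonneg: "0 \<le> c \<bullet> a" if c: "c \<in> ball ?c r" and a: "a \<in> hrec A" for c a
  proof (cases "a = 0")
    case False
    define b where "b = (1 / norm a) *\<^sub>R a"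
    have nb: "norm b = 1" using False by (simp add: b_def)
    have "b \<in> ?S" using a nb by (simp add: b_def hrec_scaleR)
    then have "r \<le> ?c \<bullet> b" using r(2) by blast
    moreover have "(?c - c) \<bullet> b \<le> norm (?c - c) * norm b" by (rule norm_cauchy_schwarz)
    moreover have "norm (?c - c) < r" using c by (simp add: dist_norm)
    ultimately have "0 < c \<bullet> b" using nb by (simp add: inner_diff_left)
    then have "0 < norm a * (c \<bullet> b)" using False by simp
    then show ?thesis using False by (simp add: b_def)
  qed simp
  let ?H = "\<Union>(x, y)\<in>{(x, y). x \<in> ?V \<and> y \<in> ?V \<and> x \<noteq> y}. {c. (x - y) \<bullet> c = 0}"
  have "finite {(x, y). x \<in> ?V \<and> y \<in> ?V \<and> x \<noteq> y}"
    by (rule finite_subset[OF _ finite_cartesian_product[OF finite_vertices[OF A] finite_vertices[OF A]]]) auto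
  then have "negligible ?H"
    by (intro negligible_Union finite_imageI) (auto intro!: negligible_hyperplane)
  moreover have "\<not> negligible (ball ?c r)" using r(1) by (intro open_not_negligible) auto
  ultimately have "\<not> ball ?c r \<subseteq> ?H" using negligible_subset by blast
  then obtain c where c: "c \<in> ball ?c r" "c \<notin> ?H" by blast
  have "inj_on (\<lambda>x. c \<bullet> x) ?V"
  proof (rule inj_onI, rule ccontr)
    fix x y assume xy: "x \<in> ?V" "y \<in> ?V" "c \<bullet> x = c \<bullet> y" "x \<noteq> y"
    then have "c \<in> {c. (x - y) \<bullet> c = 0}" by (simp add: inner_diff_right inner_commute[of _ c])
    then show False using c(2) xy(1,2,4) by auto
  qed
  then show thesis using that nonneg[OF c(1)] by blast
qed

text \<open>A primitive of the edge data: \<open>g\<close> makes all sums along edge paths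
  telescope. No base value is fixed, so constants may be added.\<close>

definition potential :: "'a::euclidean_space set \<Rightarrow> ('a set \<Rightarrow> real) \<Rightarrow> ('a \<Rightarrow> 'a) \<Rightarrow> bool" where
  "potential P t g \<longleftrightarrow> (\<forall>v w. closed_segment v w \<in> compact_edges P \<longrightarrow>
     g w - g v = t (closed_segment v w) *\<^sub>R (w - v))"

lemma edge_of_compact_2face:
  assumes "F \<in> compact_2faces P" "d edge_of F"
  shows "d \<in> compact_edges P"
  using assms face_of_trans[of d F P] face_of_imp_compact[of F d]
  by (auto simp: compact_2faces_def compact_edges_def edge_of_def face_of_imp_convex)

text \<open>
  The potential is built up along a generic functional. At each new vertex its lower neighbours must
  agree on the value, which holds around every compact 2-face below the vertex.
\<close>

lemma potential_exists:
  assumes A: "finite A" and v0: "v0 \<in> vertices (hpoly A)"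
    and cl: "\<forall>F\<in>compact_2faces (hpoly A). closes_up t F"
  obtains g where "potential (hpoly A) t g"
proof -
  let ?P = "hpoly A" and ?V = "vertices (hpoly A)"
  obtain c where c: "\<And>a. a \<in> hrec A \<Longrightarrow> 0 \<le> c \<bullet> a" and inj: "inj_on (\<lambda>x. c \<bullet> x) ?V"
    using generic_functional[OF A v0] by blast
  \<comment> \<open>The claim concerns sets of vertices closed downwards for \<open>c\<close>, so
    that each added vertex finds all its lower neighbours already treated.\<close>
  have "S \<subseteq> ?V \<Longrightarrow> (\<forall>x\<in>S. \<forall>y\<in>?V. c \<bullet> y < c \<bullet> x \<longrightarrow> y \<in> S) \<Longrightarrow>
      \<exists>g. \<forall>v\<in>S. \<forall>w\<in>S. closed_segment v w \<in> compact_edges ?P \<longrightarrow>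
        g w - g v = t (closed_segment v w) *\<^sub>R (w - v)" if "finite S" for S
    using that
  proof (induction S rule: finite_ranking_induct[where f = "\<lambda>x. c \<bullet> x"])
    case (insert x S)
    show ?case
    proof (cases "x \<in> S")
      case True
      then have "insert x S = S" by auto
      then show ?thesis using insert by simp
    next
      case xS: False
      have xV: "x \<in> ?V" and SV: "S \<subseteq> ?V" using insert.prems by auto
      have below: "y \<in> S" if "y \<in> ?V" "c \<bullet> y < c \<bullet> x" for y
        using insert.prems(2) that by auto
      have down: "\<forall>z\<in>S. \<forall>y\<in>?V. c \<bullet> y < c \<bullet> z \<longrightarrow> y \<in> S"
        using insert.prems(2) insert.hyps(2) by fastforce
      obtain g where g: "\<And>v w. v \<in> S \<Longrightarrow> w \<in> S \<Longrightarrow> closed_segment v w \<in> compact_edges ?P \<Longrightarrow>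
          g w - g v = t (closed_segment v w) *\<^sub>R (w - v)"
        using insert.IH[OF SV down] by blast
      have lower: "c \<bullet> w < c \<bullet> x" if "w \<in> S" for w
        using insert.hyps(2)[OF that] inj_onD[OF inj, of w x] that SV xV xS by force
      \<comment> \<open>The value that the edge to \<open>u\<close> forces at \<open>x\<close>; the
        task is to show that it is the same for all lower neighbours.\<close>
      define h where "h u = g u + t (closed_segment x u) *\<^sub>R (x - u)" for u
      have link: "h u = h u'" if F: "F \<in> compact_2faces ?P" "closed_segment x u edge_of F"
        "closed_segment x u' edge_of F" and low: "\<And>y. y \<in> F \<Longrightarrow> y \<noteq> x \<Longrightarrow> c \<bullet> y < c \<bullet> x" for F u u'
      proof (cases "u = u'")
        case False
        have ue: "closed_segment x u \<in> compact_edges ?P" "closed_segment x u' \<in> compact_edges ?P"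
          using edge_of_compact_2face F by auto
        then have ne: "u \<noteq> x" "u' \<noteq> x" using compact_edge_vertices(3) by blast+
        \<comment> \<open>With the value forced by \<open>u\<close> placed at \<open>x\<close>,
          every edge of \<open>F\<close> except the one to \<open>u'\<close> is correct: the edges
          missing \<open>x\<close> lie in \<open>S\<close>.\<close>
        let ?g = "g(x := h u)"
        have "?g u' - ?g x = t (closed_segment x u') *\<^sub>R (u' - x)"
        proof (rule potential_on_2face[OF _ F(2,3) False])
          show "closes_up t F" using cl F(1) by blast
          show "?g u - ?g x = t (closed_segment x u) *\<^sub>R (u - x)"
            using ne by (simp add: h_def algebra_simps)
          show "?g b - ?g a = t (closed_segment a b) *\<^sub>R (b - a)"
            if ab: "closed_segment a b edge_of F" "a \<noteq> x" "b \<noteq> x" for a b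
          proof -
            have ce: "closed_segment a b \<in> compact_edges ?P" using edge_of_compact_2face F(1) ab(1) by blast
            have "a \<in> F" "b \<in> F" using edge_of_imp_subset[OF ab(1)] by auto
            then have "a \<in> S" "b \<in> S"
              using compact_edge_vertices[OF ce] low ab(2,3) below by auto
            then show ?thesis using g ce ab by simp
          qed
        qed
        then show ?thesis using ne by (simp add: h_def algebra_simps)
      qed simp
      have hconst: "h u = h u'"
        if "u \<in> S" "u' \<in> S" "closed_segment x u \<in> compact_edges ?P" "closed_segment x u' \<in> compact_edges ?P" for u u'
      proof (rule lower_neighbours_linked[where f = h, OF A xV c])
        show "h z = h z'" if "F \<in> compact_2faces ?P" "closed_segment x z edge_of F"
          "closed_segment x z' edge_of F" "\<And>y. y \<in> F \<Longrightarrow> y \<noteq> x \<Longrightarrow> c \<bullet> y < c \<bullet> x" for F z z'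
          by (rule link[OF that])
      qed (assumption | rule that(3) lower[OF that(1)] that(4) lower[OF that(2)])+
      \<comment> \<open>If \<open>x\<close> has no lower neighbour, the value at \<open>x\<close> is
        arbitrary, as no edge joins \<open>x\<close> to \<open>S\<close>.\<close>
      define z where "z = (SOME u. u \<in> S \<and> closed_segment x u \<in> compact_edges ?P)"
      define y where "y = h z"
      have y: "h u = y" if u: "u \<in> S" "closed_segment x u \<in> compact_edges ?P" for u
      proof -
        have "z \<in> S \<and> closed_segment x z \<in> compact_edges ?P"
          unfolding z_def using conjI[OF u] by (rule someI)
        then show ?thesis unfolding y_def by (intro hconst u) auto
      qed
      have "(g(x := y)) w - (g(x := y)) v = t (closed_segment v w) *\<^sub>R (w - v)"
        if vw: "v \<in> insert x S" "w \<in> insert x S" "closed_segment v w \<in> compact_edges ?P" for v w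
      proof -
        have "v \<noteq> w" using compact_edge_vertices[OF vw(3)] by blast
        with vw consider "v = x" "w \<in> S" | "w = x" "v \<in> S" | "v \<in> S" "w \<in> S" by auto
        then show ?thesis
        proof cases
          case 1
          then show ?thesis using y[of w] vw(3) xS by (auto simp: h_def algebra_simps)
        next
          case 2
          then show ?thesis using y[of v] vw(3) xS by (auto simp: h_def closed_segment_commute)
        next
          case 3
          then show ?thesis using g vw(3) xS by auto
        qed
      qed
      then show ?thesis by blast
    qed
  qed simp
  from this[OF finite_vertices[OF A]] obtain g where
    "\<And>v w. v \<in> ?V \<Longrightarrow> w \<in> ?V \<Longrightarrow> closed_segment v w \<in> compact_edges ?P \<Longrightarrow>
        g w - g v = t (closed_segment v w) *\<^sub>R (w - v)" by blast
  then have "potential ?P t g"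
    unfolding potential_def using compact_edge_vertices by blast
  with that show thesis .
qed

text \<open>Descent for the functional exposing \<open>v0\<close> ends at \<open>v0\<close> from
  every vertex; the path is the descent read backwards.\<close>

lemma edge_path_exists:
  assumes A: "finite A" and v0: "v0 \<in> vertices (hpoly A)" and v: "v \<in> vertices (hpoly A)"
  shows "\<exists>us. edge_path (hpoly A) v0 v us"
proof (rule descent_induct[where c = "exposer A v0" and w = v0 and v = v and A = A
      and Q = "\<lambda>v. \<exists>us. edge_path (hpoly A) v0 v us"])
  show "\<exists>us. edge_path (hpoly A) v0 v0 us"
    by (intro exI[of _ "[v0]"]) (simp add: edge_path_def)
  fix v u
  assume e: "closed_segment v u \<in> compact_edges (hpoly A)" and "\<exists>us. edge_path (hpoly A) v0 u us"
  then obtain us where us: "edge_path (hpoly A) v0 u us" by blast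
  have "closed_segment ((us @ [v]) ! j) ((us @ [v]) ! Suc j) \<in> compact_edges (hpoly A)"
    if j: "Suc j < length (us @ [v])" for j
  proof (cases "Suc j = length us")
    case True
    then have "j = length us - 1" by simp
    then have "us ! j = u" using us last_conv_nth[of us] by (auto simp: edge_path_def)
    then show ?thesis using e True by (simp add: nth_append closed_segment_commute)
  next
    case False
    then show ?thesis using us j by (simp add: edge_path_def nth_append)
  qed
  then have "edge_path (hpoly A) v0 v (us @ [v])" using us by (auto simp: edge_path_def)
  then show "\<exists>us. edge_path (hpoly A) v0 v us" by blast
next
  show "x = v0" if "x \<in> vertices (hpoly A)" "exposer A v0 \<bullet> x \<le> exposer A v0 \<bullet> v0" for x
    using exposer_unique[OF A v0 _ that(2)] that(1) vertices_subset by blast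
qed (simp_all add: A v0 v exposer_hrec_nonneg)

text \<open>The sum along any path telescopes to a difference of \<open>g\<close>, so the path
  picked by \<open>SOME\<close> leaves no trace.\<close>

lemma psi_potential:
  assumes A: "finite A" and v0: "v0 \<in> vertices (hpoly A)" and v: "v \<in> vertices (hpoly A)"
    and g: "potential (hpoly A) (fst \<xi>) g"
  shows "psi (hpoly A) v0 \<xi> v = snd \<xi> v0 *\<^sub>R v0 + (g v - g v0)"
proof -
  define us where "us = (SOME us. edge_path (hpoly A) v0 v us)"
  have us: "edge_path (hpoly A) v0 v us"
    unfolding us_def using edge_path_exists[OF A v0 v] by (rule someI_ex)
  let ?n = "length us"
  have "(\<Sum>j<?n - 1. fst \<xi> (closed_segment (us ! j) (us ! Suc j)) *\<^sub>R (us ! Suc j - us ! j))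
      = (\<Sum>j<?n - 1. g (us ! Suc j) - g (us ! j))"
    using us g by (intro sum.cong) (auto simp: edge_path_def potential_def)
  also have "\<dots> = g (us ! (?n - 1)) - g (us ! 0)"
    using sum_lessThan_telescope[of "\<lambda>j. g (us ! j)"] by simp
  also have "\<dots> = g v - g v0"
    using us hd_conv_nth[of us] last_conv_nth[of us] by (auto simp: edge_path_def)
  finally show ?thesis by (simp add: psi_def us_def[symmetric] Let_def)
qed

section \<open>Minkowski summands\<close>

text \<open>The two faces are the sets of components of points of \<open>F\<close>. That sums of
  arbitrary components return to \<open>F\<close> comes from exchanging partners.\<close>

lemma face_of_set_plus:
  fixes S T :: "'a::real_vector set"
  assumes S: "convex S" and T: "convex T" and F: "F face_of S + T"
  obtains G H where "G face_of S" "H face_of T" "F = G + H"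
proof -
  define G where "G = {a\<in>S. \<exists>b\<in>T. a + b \<in> F}"
  define H where "H = {b\<in>T. \<exists>a\<in>S. a + b \<in> F}"
  have cF: "convex F" using F by (rule face_of_imp_convex)
  have faceD: "a \<in> F \<and> b \<in> F" if "x \<in> F" "x \<in> open_segment a b" "a \<in> S + T" "b \<in> S + T" for a b x
    using F that unfolding face_of_def by blast
  have shift: "x + b \<in> open_segment (y + b) (z + b)" "b + x \<in> open_segment (b + y) (b + z)"
    if "x \<in> open_segment y z" for x y z b :: 'a
    using that open_segment_translation_eq[of b x y z] by (simp_all add: add.commute)
  have "G face_of S"
    unfolding face_of_def
  proof (intro conjI ballI impI)
    show "G \<subseteq> S" by (auto simp: G_def)
    show "convex G"
    proof (rule convexI)
      fix x y and u v :: real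
      assume xy: "x \<in> G" "y \<in> G" and uv: "0 \<le> u" "0 \<le> v" "u + v = 1"
      obtain b b' where b: "b \<in> T" "x + b \<in> F" "b' \<in> T" "y + b' \<in> F" using xy by (auto simp: G_def)
      have "u *\<^sub>R (x + b) + v *\<^sub>R (y + b') \<in> F" using convexD[OF cF] b uv by blast
      then have "(u *\<^sub>R x + v *\<^sub>R y) + (u *\<^sub>R b + v *\<^sub>R b') \<in> F" by (simp add: algebra_simps)
      moreover have "u *\<^sub>R x + v *\<^sub>R y \<in> S" "u *\<^sub>R b + v *\<^sub>R b' \<in> T"
        using convexD[OF S] convexD[OF T] xy b uv by (auto simp: G_def)
      ultimately show "u *\<^sub>R x + v *\<^sub>R y \<in> G" by (auto simp: G_def)
    qed
    fix y z x assume yz: "y \<in> S" "z \<in> S" "x \<in> G" "x \<in> open_segment y z"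
    then obtain b where b: "b \<in> T" "x + b \<in> F" by (auto simp: G_def)
    have "y + b \<in> F \<and> z + b \<in> F"
      using faceD[OF b(2) shift(1)[OF yz(4)]] yz(1,2) b(1) by (blast intro: set_plus_intro)
    then show "y \<in> G" "z \<in> G" using yz b by (auto simp: G_def)
  qed
  moreover have "H face_of T"
    unfolding face_of_def
  proof (intro conjI ballI impI)
    show "H \<subseteq> T" by (auto simp: H_def)
    show "convex H"
    proof (rule convexI)
      fix x y and u v :: real
      assume xy: "x \<in> H" "y \<in> H" and uv: "0 \<le> u" "0 \<le> v" "u + v = 1"
      obtain b b' where b: "b \<in> S" "b + x \<in> F" "b' \<in> S" "b' + y \<in> F" using xy by (auto simp: H_def)
      have "u *\<^sub>R (b + x) + v *\<^sub>R (b' + y) \<in> F" using convexD[OF cF] b uv by blast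
      then have "(u *\<^sub>R b + v *\<^sub>R b') + (u *\<^sub>R x + v *\<^sub>R y) \<in> F" by (simp add: algebra_simps)
      moreover have "u *\<^sub>R x + v *\<^sub>R y \<in> T" "u *\<^sub>R b + v *\<^sub>R b' \<in> S"
        using convexD[OF S] convexD[OF T] xy b uv by (auto simp: H_def)
      ultimately show "u *\<^sub>R x + v *\<^sub>R y \<in> H" by (auto simp: H_def)
    qed
    fix y z x assume yz: "y \<in> T" "z \<in> T" "x \<in> H" "x \<in> open_segment y z"
    then obtain b where b: "b \<in> S" "b + x \<in> F" by (auto simp: H_def)
    have "b + y \<in> F \<and> b + z \<in> F"
      using faceD[OF b(2) shift(2)[OF yz(4)]] yz(1,2) b(1) by (blast intro: set_plus_intro)
    then show "y \<in> H" "z \<in> H" using yz b by (auto simp: H_def)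
  qed
  moreover have "F = G + H"
  proof
    show "F \<subseteq> G + H"
    proof
      fix x assume x: "x \<in> F"
      then have "x \<in> S + T" using F face_of_imp_subset by blast
      then obtain a b where "a \<in> S" "b \<in> T" "x = a + b" by (auto elim: set_plus_elim)
      then show "x \<in> G + H" using x by (auto simp: G_def H_def)
    qed
    show "G + H \<subseteq> F"
    proof
      fix x assume "x \<in> G + H"
      then obtain a b where ab: "a \<in> G" "b \<in> H" "x = a + b" by (auto elim: set_plus_elim)
      then obtain a' b' where ab': "a \<in> S" "b' \<in> T" "a + b' \<in> F" "a' \<in> S" "b \<in> T" "a' + b \<in> F"
        by (auto simp: G_def H_def)
      let ?m = "midpoint (a + b') (a' + b)"
      \<comment> \<open>\<open>a + b'\<close> and \<open>a' + b\<close> lie in \<open>F\<close> and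
        have the same midpoint as \<open>a + b\<close> and \<open>a' + b'\<close>; extremality moves
        the latter pair into \<open>F\<close>.\<close>
      have m: "?m = midpoint (a + b) (a' + b')" by (simp add: midpoint_def algebra_simps)
      have mF: "?m \<in> F" using cF ab'(3,6) by (meson closed_segment_subset midpoint_in_closed_segment subsetD)
      show "x \<in> F"
      proof (cases "a + b = a' + b'")
        case True
        then show ?thesis using m mF ab(3) by simp
      next
        case False
        then have "?m \<in> open_segment (a + b) (a' + b')" by (simp add: m)
        then show ?thesis using faceD[OF mF, of "a + b" "a' + b'"] ab' ab(3) by (auto intro: set_plus_intro)
      qed
    qed
  qed
  ultimately show thesis using that by blast
qed

text \<open>Polyhedra are the closed convex sets with finitely many faces. Faces of the sum come
  from pairs of faces, and compactness of \<open>S\<close> gives closedness.\<close>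

lemma polyhedron_set_plus:
  fixes S T :: "'a::euclidean_space set"
  assumes "polyhedron S" "compact S" "polyhedron T"
  shows "polyhedron (S + T)"
  unfolding polyhedron_eq_finite_faces
proof (intro conjI)
  have ST: "closed T" "convex S" "convex T" "finite {F. F face_of S}" "finite {F. F face_of T}"
    using assms by (auto simp: polyhedron_eq_finite_faces)
  have "S + T = (\<Union>x\<in>S. \<Union>y\<in>T. {x + y})" by (auto simp: set_plus_def)
  then show "closed (S + T)" using compact_closed_sums[OF assms(2) ST(1)] by simp
  show "convex (S + T)" using ST by (intro convex_set_plus)
  have "{F. F face_of S + T} \<subseteq> (\<lambda>(G, H). G + H) ` ({F. F face_of S} \<times> {F. F face_of T})"
  proof
    fix F assume "F \<in> {F. F face_of S + T}"
    then obtain G H where "G face_of S" "H face_of T" "F = G + H"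
      using face_of_set_plus[OF ST(2,3)] by blast
    then show "F \<in> (\<lambda>(G, H). G + H) ` ({F. F face_of S} \<times> {F. F face_of T})" by auto
  qed
  then show "finite {F. F face_of S + T}" using ST(4,5) finite_subset by blast
qed

text \<open>The shape of \<open>P_param\<close>, with an arbitrary map on the vertices and the tail
  written as \<open>hrec A\<close>.\<close>

definition summand :: "('a::euclidean_space \<times> real) set \<Rightarrow> ('a \<Rightarrow> 'a) \<Rightarrow> 'a set" where
  "summand A g = convex hull (g ` vertices (hpoly A)) + hrec A"

lemma summand_vertex: "v \<in> vertices (hpoly A) \<Longrightarrow> g v \<in> summand A g"
proof -
  assume v: "v \<in> vertices (hpoly A)"
  have "g v + 0 \<in> summand A g"
    unfolding summand_def by (intro set_plus_intro hull_inc hrec_zero imageI v)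
  then show ?thesis by simp
qed

lemma summand_add_hrec:
  assumes "x \<in> summand A g" "a \<in> hrec A"
  shows "x + a \<in> summand A g"
proof -
  obtain y b where yb: "y \<in> convex hull (g ` vertices (hpoly A))" "b \<in> hrec A" "x = y + b"
    using assms(1) unfolding summand_def by (auto elim: set_plus_elim)
  then have "y + (b + a) \<in> summand A g"
    unfolding summand_def using assms(2) by (intro set_plus_intro hrec_add)
  then show ?thesis using yb(3) by (simp add: add.assoc)
qed

lemma polyhedron_summand: "finite A \<Longrightarrow> polyhedron (summand A g)"
  unfolding summand_def
  by (intro polyhedron_set_plus polyhedron_hrec polyhedron_convex_hull finite_imp_compact_convex_hull
      finite_imageI finite_vertices)

lemma summand_ge:
  assumes "\<And>a. a \<in> hrec A \<Longrightarrow> 0 \<le> c \<bullet> a" "\<And>v. v \<in> vertices (hpoly A) \<Longrightarrow> b \<le> c \<bullet> g v"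
    and "x \<in> summand A g"
  shows "b \<le> c \<bullet> x"
proof -
  obtain y a where ya: "y \<in> convex hull (g ` vertices (hpoly A))" "a \<in> hrec A" "x = y + a"
    using assms(3) unfolding summand_def by (auto elim: set_plus_elim)
  have "b \<le> c \<bullet> y" using hull_halfspace_ge[OF _ ya(1), of b c] assms(2) by blast
  then show ?thesis using assms(1)[OF ya(2)] ya(3) by (simp add: inner_add_right)
qed

text \<open>Each normal in \<open>A\<close> is nonnegative on the cone and hence bounded below on
  the summand by its least value on the image vertices; iterating a tail vector cannot break this
  bound.\<close>

lemma tail_summand:
  assumes A: "finite A" and w: "w \<in> vertices (hpoly A)"
  shows "tail (summand A g) = hrec A"
proof
  show "hrec A \<subseteq> tail (summand A g)"
    unfolding tail_def using summand_add_hrec by (fastforce simp: add.commute)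
  show "tail (summand A g) \<subseteq> hrec A"
  proof
    fix a assume a: "a \<in> tail (summand A g)"
    have "0 \<le> fst h \<bullet> a" if h: "h \<in> A" for h
    proof (rule ccontr)
      assume neg: "\<not> 0 \<le> fst h \<bullet> a"
      let ?m = "Min ((\<lambda>v. fst h \<bullet> g v) ` vertices (hpoly A))"
      have "?m \<le> fst h \<bullet> (g w + real n *\<^sub>R a)" for n
      proof (rule summand_ge)
        show "g w + real n *\<^sub>R a \<in> summand A g" by (intro tail_iterate a summand_vertex w)
        show "0 \<le> fst h \<bullet> b" if "b \<in> hrec A" for b using that h by (auto simp: hrec_def)
        show "?m \<le> fst h \<bullet> g v" if "v \<in> vertices (hpoly A)" for v
          using that finite_vertices[OF A] by (intro Min_le) auto
      qed
      then have "?m \<le> fst h \<bullet> g w + real n * (fst h \<bullet> a)" for n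
        by (simp add: inner_add_right)
      with neg show False using real_unbounded_contradiction[of "fst h \<bullet> a"] by auto
    qed
    then show "a \<in> hrec A" by (simp add: hrec_def)
  qed
qed

text \<open>Going up an edge, \<open>g\<close> moves by a nonnegative multiple of the edge vector.
  In the second part, absence of any increase makes all coefficients along a descending path zero,
  so the image points coincide; this yields unique minima on summands.\<close>

lemma potential_mono:
  assumes A: "finite A" and g: "potential (hpoly A) t g" and t: "\<forall>d\<in>compact_edges (hpoly A). 0 \<le> t d"
    and w: "w \<in> vertices (hpoly A)" and c: "\<And>a. a \<in> hrec A \<Longrightarrow> 0 \<le> c \<bullet> a"
    and min: "\<And>x. x \<in> vertices (hpoly A) \<Longrightarrow> c \<bullet> x \<le> c \<bullet> w \<Longrightarrow> x = w"
    and v: "v \<in> vertices (hpoly A)"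
  shows "c \<bullet> g w \<le> c \<bullet> g v" "c \<bullet> g v \<le> c \<bullet> g w \<Longrightarrow> g v = g w"
proof -
  have "c \<bullet> g w \<le> c \<bullet> g v \<and> (c \<bullet> g v \<le> c \<bullet> g w \<longrightarrow> g v = g w)"
  proof (rule descent_induct[where Q = "\<lambda>v. c \<bullet> g w \<le> c \<bullet> g v \<and> (c \<bullet> g v \<le> c \<bullet> g w \<longrightarrow> g v = g w)",
        OF A w c min _ _ v])
    fix v u
    assume e: "closed_segment v u \<in> compact_edges (hpoly A)" and lt: "c \<bullet> u < c \<bullet> v"
      and IH: "c \<bullet> g w \<le> c \<bullet> g u \<and> (c \<bullet> g u \<le> c \<bullet> g w \<longrightarrow> g u = g w)"
    define T where "T = t (closed_segment v u)"
    have T: "0 \<le> T" using t e by (simp add: T_def)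
    have "g u - g v = T *\<^sub>R (u - v)" using g e unfolding potential_def T_def by blast
    then have eq: "g v = g u + T *\<^sub>R (v - u)" by (simp add: algebra_simps)
    then have ceq: "c \<bullet> g v = c \<bullet> g u + T * (c \<bullet> v - c \<bullet> u)" by (simp add: inner_add_right inner_diff_right)
    have nn: "0 \<le> T * (c \<bullet> v - c \<bullet> u)" using T lt by simp
    have "g v = g w" if "c \<bullet> g v \<le> c \<bullet> g w"
    proof -
      have "T * (c \<bullet> v - c \<bullet> u) = 0" using that nn ceq IH by linarith
      then have "T = 0" using lt by simp
      then have "g v = g u" using eq by simp
      then show ?thesis using IH that by metis
    qed
    moreover have "c \<bullet> g w \<le> c \<bullet> g v" using IH nn ceq by linarith
    ultimately show "c \<bullet> g w \<le> c \<bullet> g v \<and> (c \<bullet> g v \<le> c \<bullet> g w \<longrightarrow> g v = g w)" by blast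
  qed (simp_all add: v)
  then show "c \<bullet> g w \<le> c \<bullet> g v" "c \<bullet> g v \<le> c \<bullet> g w \<Longrightarrow> g v = g w" by blast+
qed

text \<open>A minimum of \<open>c\<close> need not be unique; it is for \<open>c + \<epsilon> e\<close> with \<open>e\<close> exposing the vertex.\<close>

lemma potential_min:
  assumes A: "finite A" and g: "potential (hpoly A) t g" and t: "\<forall>d\<in>compact_edges (hpoly A). 0 \<le> t d"
    and w: "w \<in> vertices (hpoly A)" and c: "\<And>a. a \<in> hrec A \<Longrightarrow> 0 \<le> c \<bullet> a"
    and min: "\<And>x. x \<in> hpoly A \<Longrightarrow> c \<bullet> w \<le> c \<bullet> x"
    and v: "v \<in> vertices (hpoly A)"
  shows "c \<bullet> g w \<le> c \<bullet> g v"
proof (rule ccontr)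
  assume "\<not> c \<bullet> g w \<le> c \<bullet> g v"
  then have D: "0 < c \<bullet> g w - c \<bullet> g v" by simp
  let ?e = "exposer A w"
  let ?K = "?e \<bullet> g v - ?e \<bullet> g w"
  have *: "c \<bullet> g w - c \<bullet> g v \<le> r * ?K" if r: "0 < r" for r
  proof -
    have "(c + r *\<^sub>R ?e) \<bullet> g w \<le> (c + r *\<^sub>R ?e) \<bullet> g v"
    proof (rule potential_mono(1)[OF A g t w _ _ v])
      show "0 \<le> (c + r *\<^sub>R ?e) \<bullet> a" if "a \<in> hrec A" for a
        using c[OF that] exposer_hrec_nonneg[OF that] r by (simp add: inner_add_left)
      show "x = w" if x: "x \<in> vertices (hpoly A)" "(c + r *\<^sub>R ?e) \<bullet> x \<le> (c + r *\<^sub>R ?e) \<bullet> w" for x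
      proof -
        have xP: "x \<in> hpoly A" using x(1) vertices_subset by blast
        have "r * (?e \<bullet> x) \<le> r * (?e \<bullet> w)" using x(2) min[OF xP] by (simp add: inner_add_left)
        then show ?thesis using exposer_unique[OF A w xP] r by simp
      qed
    qed
    then show ?thesis by (simp add: inner_add_left algebra_simps)
  qed
  have K: "0 < ?K" using *[of 1] D by simp
  \<comment> \<open>The choice of \<open>r\<close> halves the positive gap on the right-hand side, a
    contradiction.\<close>
  have "c \<bullet> g w - c \<bullet> g v \<le> (c \<bullet> g w - c \<bullet> g v) / (2 * ?K) * ?K" using D K by (intro *) simp
  also have "\<dots> = (c \<bullet> g w - c \<bullet> g v) / 2" using K by (simp add: field_simps)
  finally show False using D by simp
qed

lemma min_face_summand_vertex:
  assumes A: "finite A" and g: "potential (hpoly A) t g" and t: "\<forall>d\<in>compact_edges (hpoly A). 0 \<le> t d"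
    and w: "w \<in> vertices (hpoly A)" and c: "\<And>a. a \<in> hrec A \<Longrightarrow> 0 \<le> c \<bullet> a"
    and min: "\<And>x. x \<in> hpoly A \<Longrightarrow> c \<bullet> w \<le> c \<bullet> x"
  shows "g w \<in> min_face (summand A g) c"
  using summand_ge[OF c potential_min[OF A g t w c min]] summand_vertex[OF w]
  by (simp add: min_face_def inner_commute[of _ c])

text \<open>Allows a hull argument with strict inequalities: if all generators other than
  \<open>z\<close> lie strictly above it, the hull meets the level of \<open>z\<close> only in
  \<open>z\<close>.\<close>

lemma convex_insert_open_halfspace: "convex (insert z {x. c \<bullet> z < c \<bullet> x})"
proof (rule convexI)
  fix x y and u v :: real
  assume xy: "x \<in> insert z {x. c \<bullet> z < c \<bullet> x}" "y \<in> insert z {x. c \<bullet> z < c \<bullet> x}"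
    and uv: "0 \<le> u" "0 \<le> v" "u + v = 1"
  have eq: "c \<bullet> (u *\<^sub>R x + v *\<^sub>R y) - (u + v) * (c \<bullet> z) = u * (c \<bullet> x - c \<bullet> z) + v * (c \<bullet> y - c \<bullet> z)"
    by (simp add: inner_add_right algebra_simps)
  have nn: "0 \<le> u * (c \<bullet> x - c \<bullet> z)" "0 \<le> v * (c \<bullet> y - c \<bullet> z)" using xy uv by auto
  show "u *\<^sub>R x + v *\<^sub>R y \<in> insert z {x. c \<bullet> z < c \<bullet> x}"
  proof (cases "c \<bullet> z < c \<bullet> (u *\<^sub>R x + v *\<^sub>R y)")
    case False
    then have "u * (c \<bullet> x - c \<bullet> z) = 0" "v * (c \<bullet> y - c \<bullet> z) = 0"
      using eq[unfolded uv(3)] nn by linarith+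
    then have "u *\<^sub>R x = u *\<^sub>R z" "v *\<^sub>R y = v *\<^sub>R z" using xy by auto
    then have "u *\<^sub>R x + v *\<^sub>R y = (u + v) *\<^sub>R z" by (simp only: scaleR_add_left)
    then have "u *\<^sub>R x + v *\<^sub>R y = z" using uv(3) by simp
    then show ?thesis by simp
  qed simp
qed

text \<open>Image vertices at the minimal level equal \<open>g w\<close>, and nonzero recession
  vectors strictly raise \<open>c\<close> because its minimum on \<open>hpoly A\<close> is
  unique.\<close>

lemma min_face_summand:
  assumes A: "finite A" and g: "potential (hpoly A) t g" and t: "\<forall>d\<in>compact_edges (hpoly A). 0 \<le> t d"
    and w: "w \<in> vertices (hpoly A)" and c: "min_face (hpoly A) c = {w}"
  shows "min_face (summand A g) c = {g w}"
proof -
  have min: "c \<bullet> w \<le> c \<bullet> x" if "x \<in> hpoly A" for x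
    using c that by (auto simp: min_face_def inner_commute[of _ c])
  have uniq: "x = w" if "x \<in> hpoly A" "c \<bullet> x \<le> c \<bullet> w" for x
  proof -
    have "x \<in> min_face (hpoly A) c" using that min by (force simp: min_face_def inner_commute[of _ c])
    then show ?thesis using c by simp
  qed
  have wP: "w \<in> hpoly A" using w vertices_subset by blast
  have rec: "0 \<le> c \<bullet> a" if "a \<in> hrec A" for a
    using min[OF hpoly_add_hrec[OF wP that]] by (simp add: inner_add_right)
  have rec0: "a = 0" if "a \<in> hrec A" "c \<bullet> a \<le> 0" for a
    using uniq[OF hpoly_add_hrec[OF wP that(1)]] that(2) by (simp add: inner_add_right)
  have uniqV: "\<And>x. x \<in> vertices (hpoly A) \<Longrightarrow> c \<bullet> x \<le> c \<bullet> w \<Longrightarrow> x = w"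
    using uniq vertices_subset by blast
  have "g ` vertices (hpoly A) \<subseteq> insert (g w) {x. c \<bullet> g w < c \<bullet> x}"
    using potential_mono(2)[OF A g t w rec uniqV] by force
  then have hull: "convex hull (g ` vertices (hpoly A)) \<subseteq> insert (g w) {x. c \<bullet> g w < c \<bullet> x}"
    by (intro hull_minimal convex_insert_open_halfspace)
  have "x = g w" if x: "x \<in> min_face (summand A g) c" for x
  proof -
    have "x \<in> summand A g" and le: "c \<bullet> x \<le> c \<bullet> g w"
      using x summand_vertex[OF w, of g] by (auto simp: min_face_def inner_commute[of _ c])
    then obtain y a where ya: "y \<in> convex hull (g ` vertices (hpoly A))" "a \<in> hrec A" "x = y + a"
      unfolding summand_def by (auto elim: set_plus_elim)
    have "y = g w \<or> c \<bullet> g w < c \<bullet> y" using hull ya(1) by blast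
    then have "y = g w" "c \<bullet> a \<le> 0" using le rec[OF ya(2)] by (auto simp: ya(3) inner_add_right)
    then show ?thesis using rec0[OF ya(2)] ya(3) by simp
  qed
  then show ?thesis using min_face_summand_vertex[OF A g t w rec min] by blast
qed

text \<open>The exposing functional may leave \<open>span N\<close>, where \<open>tail_dual\<close>
  lives; its orthogonal projection has the same values on \<open>hpoly A\<close>.\<close>

lemma exposing_functional_in_span:
  assumes A: "finite A" and w: "w \<in> vertices (hpoly A)" and PN: "hpoly A \<subseteq> span N"
  obtains c where "c \<in> tail_dual N (hpoly A)" "min_face (hpoly A) c = {w}"
proof -
  obtain c z where cz: "c \<in> span N" "\<And>x. x \<in> span N \<Longrightarrow> orthogonal z x" "exposer A w = c + z"
    using orthogonal_subspace_decomp_exists[of N "exposer A w"] by blast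
  have eq: "c \<bullet> x = exposer A w \<bullet> x" if "x \<in> span N" for x
    using cz(2)[OF that] cz(3) by (simp add: inner_add_left orthogonal_def)
  have wP: "w \<in> hpoly A" using w vertices_subset by blast
  have "0 \<le> a \<bullet> c" if a: "a \<in> tail (hpoly A)" for a
  proof -
    have a': "a \<in> hrec A" using a tail_hpoly[of A] wP by blast
    then have "(w + a) - w \<in> span N" using hpoly_add_hrec[OF wP] wP PN by (intro span_diff) auto
    then show ?thesis using exposer_hrec_nonneg[OF a', of w] eq[of a] by (simp add: inner_commute)
  qed
  then have "c \<in> tail_dual N (hpoly A)" using cz(1) by (simp add: tail_dual_def)
  moreover have "min_face (hpoly A) c = {w}"
  proof -
    have eqP: "x \<bullet> c = exposer A w \<bullet> x" if "x \<in> hpoly A" for x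
      using eq[of x] that PN by (auto simp: inner_commute)
    show ?thesis
      using exposer_min[of _ A w] exposer_unique[OF A w] wP eqP by (auto simp: min_face_def)
  qed
  ultimately show thesis using that by blast
qed

lemma vertex_in_summand:
  assumes A: "finite A" and g: "potential (hpoly A) t g" and t: "\<forall>d\<in>compact_edges (hpoly A). 0 \<le> t d"
    and w: "w \<in> vertices (hpoly A)" and PN: "hpoly A \<subseteq> span N"
  shows "vertex_in N (hpoly A) w (summand A g) = g w"
  unfolding vertex_in_def
proof (rule the_equality)
  obtain c where "c \<in> tail_dual N (hpoly A)" "min_face (hpoly A) c = {w}"
    using exposing_functional_in_span[OF A w PN] .
  then show "\<exists>c\<in>tail_dual N (hpoly A). min_face (hpoly A) c = {w} \<and> min_face (summand A g) c = {g w}"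
    using min_face_summand[OF A g t w] by blast
  show "x = g w" if "\<exists>c\<in>tail_dual N (hpoly A). min_face (hpoly A) c = {w} \<and> min_face (summand A g) c = {x}" for x
    using that min_face_summand[OF A g t w] by (metis singleton_inject)
qed

text \<open>For each inequality of \<open>A\<close>, one vertex \<open>w\<close> minimises its
  normal on \<open>hpoly A\<close> and its images minimise it on all summands at once; adding up
  gives one inclusion. The other follows from the decomposition into vertices and recession
  cone.\<close>

lemma sum_summands:
  assumes A: "finite A" and v0: "v0 \<in> vertices (hpoly A)"
    and g: "\<And>i. i \<le> k \<Longrightarrow> potential (hpoly A) (t i) (g i)"
    and t: "\<And>i. i \<le> k \<Longrightarrow> \<forall>d\<in>compact_edges (hpoly A). 0 \<le> t i d"
    and sum: "\<And>v. v \<in> vertices (hpoly A) \<Longrightarrow> (\<Sum>i\<le>(k::nat). g i v) = v"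
  shows "(\<Sum>i\<le>k. summand A (g i)) = hpoly A"
proof
  have pt: "pointed A" using vertex_pointed[OF A v0] .
  have ne: "hpoly A \<noteq> {}" using v0 vertices_subset by blast
  show "(\<Sum>i\<le>k. summand A (g i)) \<subseteq> hpoly A"
  proof
    fix x assume "x \<in> (\<Sum>i\<le>k. summand A (g i))"
    then obtain y where y: "\<And>i. i \<le> k \<Longrightarrow> y i \<in> summand A (g i)" "x = (\<Sum>i\<le>k. y i)"
      by (auto simp: set_sum_alt)
    have "snd h \<le> fst h \<bullet> x" if h: "h \<in> A" for h
    proof -
      have c: "\<And>a. a \<in> hrec A \<Longrightarrow> 0 \<le> fst h \<bullet> a" using h by (auto simp: hrec_def)
      obtain w where w: "w \<in> vertices (hpoly A)" "\<And>x. x \<in> hpoly A \<Longrightarrow> fst h \<bullet> w \<le> fst h \<bullet> x"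
        using vertex_minimum[OF A pt ne c] by blast
      have "fst h \<bullet> g i w \<le> fst h \<bullet> y i" if i: "i \<le> k" for i
        using summand_ge[OF c potential_min[OF A g[OF i] t[OF i] w(1) c w(2)] y(1)[OF i]] .
      then have "(\<Sum>i\<le>k. fst h \<bullet> g i w) \<le> (\<Sum>i\<le>k. fst h \<bullet> y i)" by (intro sum_mono) auto
      then have "fst h \<bullet> w \<le> fst h \<bullet> x" using sum[OF w(1)] y(2) by (simp flip: inner_sum_right)
      moreover have "snd h \<le> fst h \<bullet> w" using w(1) h vertices_subset by (fastforce simp: hpoly_def)
      ultimately show ?thesis by simp
    qed
    then show "x \<in> hpoly A" by (simp add: hpoly_def)
  qed
  let ?S = "\<Sum>i\<le>k. summand A (g i)"
  have "convex ?S"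
    using polyhedron_imp_convex[OF polyhedron_summand[OF A]] by (intro convex_set_sum) auto
  moreover have "v \<in> ?S" if "v \<in> vertices (hpoly A)" for v
    using sum[OF that] summand_vertex[OF that] by (auto simp: set_sum_alt intro!: exI[of _ "\<lambda>i. g i v"])
  ultimately have "convex hull (vertices (hpoly A)) \<subseteq> ?S" by (intro hull_minimal) auto
  moreover have "x + a \<in> ?S" if x: "x \<in> ?S" and a: "a \<in> hrec A" for x a
  proof -
    obtain y where y: "\<And>i. i \<le> k \<Longrightarrow> y i \<in> summand A (g i)" "x = (\<Sum>i\<le>k. y i)"
      using x by (auto simp: set_sum_alt)
    \<comment> \<open>The whole recession vector is put into the summand of index 0.\<close>
    have "x + a = (\<Sum>i\<le>k. y i + (if i = 0 then a else 0))"
      by (simp add: y(2) sum.distrib)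
    moreover have "y i + (if i = 0 then a else 0) \<in> summand A (g i)" if "i \<le> k" for i
      using y(1)[OF that] summand_add_hrec[OF _ a] by auto
    ultimately show ?thesis by (auto simp: set_sum_alt intro!: exI[of _ "\<lambda>i. y i + (if i = 0 then a else 0)"])
  qed
  ultimately show "hpoly A \<subseteq> ?S"
    using hpoly_decomposition[OF A pt] by (blast elim: set_plus_elim)
qed

section \<open>Integrality\<close>

lemma lattice_zero:
  assumes "is_lattice N"
  shows "0 \<in> N"
proof -
  obtain B where N: "N = {(\<Sum>b\<in>B. of_int (z b) *\<^sub>R b) | z :: 'a \<Rightarrow> int. True}"
    using assms unfolding is_lattice_def by blast
  show ?thesis unfolding N by (intro CollectI exI[of _ "\<lambda>_. 0"]) simp
qed

lemma lattice_diff: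
  assumes "is_lattice N" "x \<in> N" "y \<in> N"
  shows "x - y \<in> N"
proof -
  obtain B where N: "N = {(\<Sum>b\<in>B. of_int (z b) *\<^sub>R b) | z :: 'a \<Rightarrow> int. True}"
    using assms(1) unfolding is_lattice_def by blast
  obtain z z' :: "'a \<Rightarrow> int" where "x = (\<Sum>b\<in>B. of_int (z b) *\<^sub>R b)" "y = (\<Sum>b\<in>B. of_int (z' b) *\<^sub>R b)"
    using assms(2,3) unfolding N by blast
  then have "x - y = (\<Sum>b\<in>B. of_int (z b - z' b) *\<^sub>R b)"
    by (simp add: scaleR_diff_left sum_subtractf)
  then show ?thesis unfolding N by (intro CollectI exI[of _ "\<lambda>b. z b - z' b"]) simp
qed

lemma lattice_uminus: "is_lattice N \<Longrightarrow> x \<in> N \<Longrightarrow> - x \<in> N"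
  using lattice_diff[of N 0 x] lattice_zero[of N] by simp

lemma lattice_add: "is_lattice N \<Longrightarrow> x \<in> N \<Longrightarrow> y \<in> N \<Longrightarrow> x + y \<in> N"
  using lattice_diff[of N x "- y"] lattice_uminus[of N y] by simp

lemma lattice_sum: "is_lattice N \<Longrightarrow> (\<And>i. i \<in> I \<Longrightarrow> f i \<in> N) \<Longrightarrow> sum f I \<in> N"
  by (induction I rule: infinite_finite_induct) (auto simp: lattice_zero lattice_add)

lemma polyhedron_rational_polyhedron:
  assumes "rational_polyhedron N P"
  shows "polyhedron P" "P \<subseteq> span N"
proof -
  obtain A where A: "finite A" "P = {x \<in> span N. \<forall>(u, b)\<in>A. b \<le> u \<bullet> x}"
    using assms unfolding rational_polyhedron_def by blast
  have "P = span N \<inter> \<Inter> ((\<lambda>h. {x. fst h \<bullet> x \<ge> snd h}) ` A)"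
    unfolding A(2) by (auto simp: case_prod_beta)
  moreover have "polyhedron (span N)" by (intro affine_imp_polyhedron subspace_imp_affine subspace_span)
  moreover have "polyhedron (\<Inter> ((\<lambda>h. {x. fst h \<bullet> x \<ge> snd h}) ` A))"
    using A(1) by (auto intro!: polyhedron_Inter polyhedron_halfspace_ge)
  ultimately show "polyhedron P" by simp
  show "P \<subseteq> span N" unfolding A(2) by blast
qed

lemma sum_fun_apply: "(\<Sum>i\<in>I. f i) x = (\<Sum>i\<in>I. f i x)" for f :: "_ \<Rightarrow> _ \<Rightarrow> 'b::comm_monoid_add"
  by (induction I rule: infinite_finite_induct) auto

lemma unit_of_sum_le_1:
  fixes s :: "'i \<Rightarrow> real"
  assumes "finite I" "\<And>i. i \<in> I \<Longrightarrow> 0 \<le> s i" "sum s I \<le> 1" "m \<in> I" "s m = 1" "i \<in> I" "i \<noteq> m"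
  shows "s i = 0"
proof -
  have "s m + s i = sum s {m, i}" using assms by simp
  also have "\<dots> \<le> sum s I" using assms by (intro sum_mono2) auto
  finally show ?thesis using assms by force
qed

section \<open>Summands given by parameters adding up to \<open>one_param\<close>\<close>

locale minkowski_parameters =
  fixes N :: "'a::euclidean_space set" and A :: "('a \<times> real) set" and v0 :: 'a
    and k :: nat and \<xi> :: "nat \<Rightarrow> 'a param"
  assumes lattice: "is_lattice N" and A: "finite A" and PN: "hpoly A \<subseteq> span N"
    and v0: "v0 \<in> vertices (hpoly A)" "v0 \<notin> N \<or> v0 = 0"
    and \<xi>: "\<And>i. i \<le> k \<Longrightarrow> \<xi> i \<in> T_plus N (hpoly A)"
    and sum_\<xi>: "(\<Sum>i\<le>k. \<xi> i) = one_param N (hpoly A)"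
begin

abbreviation "P \<equiv> hpoly A"
abbreviation "t i \<equiv> fst (\<xi> i)"
abbreviation "s i \<equiv> snd (\<xi> i)"
abbreviation "\<psi> i \<equiv> psi P v0 (\<xi> i)"
abbreviation "Q i \<equiv> P_param P v0 (\<xi> i)"

lemma ne: "P \<noteq> {}"
  using v0 vertices_subset by blast

lemma tail_P: "tail P = hrec A"
  using tail_hpoly[OF ne] .

lemma Q_eq: "Q i = summand A (\<psi> i)"
  by (simp add: P_param_def summand_def tail_P)

lemma mem_T: "i \<le> k \<Longrightarrow> \<xi> i \<in> T N P"
  using \<xi> by (fastforce simp: T_plus_def)

lemma t_nonneg: "i \<le> k \<Longrightarrow> \<forall>d\<in>compact_edges P. 0 \<le> t i d"
  using \<xi>[of i] by (auto simp: T_plus_def)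

lemma s_nonneg: "i \<le> k \<Longrightarrow> v \<in> vertices P \<Longrightarrow> 0 \<le> s i v"
  using \<xi>[of i] by (auto simp: T_plus_def)

lemma s_lattice: "i \<le> k \<Longrightarrow> v \<in> vertices P \<Longrightarrow> v \<in> N \<Longrightarrow> s i v = 0"
  using mem_T[of i] by (auto simp: T_def)

lemma sum_t: "d \<in> compact_edges P \<Longrightarrow> (\<Sum>i\<le>k. t i d) = 1"
  using arg_cong[OF sum_\<xi>, of "\<lambda>x. fst x d"] by (simp add: fst_sum sum_fun_apply one_param_def)

lemma sum_s: "v \<in> vertices P \<Longrightarrow> (\<Sum>i\<le>k. s i v) = (if v \<in> N then 0 else 1)"
  using arg_cong[OF sum_\<xi>, of "\<lambda>x. snd x v"] by (simp add: snd_sum sum_fun_apply one_param_def)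

lemma s_unique:
  assumes "v \<in> vertices P" "m \<le> k" "s m v = 1" "i \<le> k" "i \<noteq> m"
  shows "s i v = 0"
  using unit_of_sum_le_1[of "{..k}" "\<lambda>i. s i v" m i] assms s_nonneg sum_s[of v] by auto

text \<open>On the vertices \<open>\<psi> i\<close> differs from a potential by a constant, so it is
  a potential itself, with its base value fixed at \<open>v0\<close>.\<close>

lemma psi_v0_potential:
  assumes "i \<le> k"
  shows "potential P (t i) (\<psi> i)" "\<psi> i v0 = s i v0 *\<^sub>R v0"
proof -
  have "\<forall>F\<in>compact_2faces P. closes_up (t i) F" using mem_T[OF assms] by (auto simp: T_def)
  then obtain g where g: "potential P (t i) g" using potential_exists[OF A v0(1)] by blast
  note psi = psi_potential[OF A v0(1) _ g]
  show "\<psi> i v0 = s i v0 *\<^sub>R v0" using psi[OF v0(1)] by simp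
  show "potential P (t i) (\<psi> i)"
    unfolding potential_def
  proof (intro allI impI)
    fix v w assume e: "closed_segment v w \<in> compact_edges P"
    have "\<psi> i w - \<psi> i v = g w - g v"
      using psi compact_edge_vertices[OF e] by simp
    then show "\<psi> i w - \<psi> i v = t i (closed_segment v w) *\<^sub>R (w - v)"
      using g e by (simp add: potential_def)
  qed
qed

lemmas psi_edge = psi_v0_potential(1)[unfolded potential_def, rule_format]

lemma vertex_connected_induct:
  assumes "R v0" "\<And>v u. closed_segment v u \<in> compact_edges P \<Longrightarrow> R u \<Longrightarrow> R v" "v \<in> vertices P"
  shows "R v"
proof (rule descent_induct[where Q = R, OF A v0(1) exposer_hrec_nonneg _ assms(1) assms(2) assms(3)])
  show "x = v0" if "x \<in> vertices P" "exposer A v0 \<bullet> x \<le> exposer A v0 \<bullet> v0" for x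
    using exposer_unique[OF A v0(1) _ that(2)] that(1) vertices_subset by blast
qed

lemma sum_psi:
  assumes "v \<in> vertices P"
  shows "(\<Sum>i\<le>k. \<psi> i v) = v"
proof (rule vertex_connected_induct[where R = "\<lambda>v. (\<Sum>i\<le>k. \<psi> i v) = v", OF _ _ assms])
  have "(\<Sum>i\<le>k. \<psi> i v0) = (\<Sum>i\<le>k. s i v0) *\<^sub>R v0"
    by (simp add: psi_v0_potential(2) scaleR_sum_left)
  \<comment> \<open>The coefficients at \<open>v0\<close> add up to 1 if \<open>v0\<close> is not in
    \<open>N\<close> and to 0 otherwise; in the latter case \<open>v0 = 0\<close>.\<close>
  then show "(\<Sum>i\<le>k. \<psi> i v0) = v0" using sum_s[OF v0(1)] v0(2) by auto
  fix v u assume e: "closed_segment v u \<in> compact_edges P" and IH: "(\<Sum>i\<le>k. \<psi> i u) = u"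
  have "(\<Sum>i\<le>k. \<psi> i u) - (\<Sum>i\<le>k. \<psi> i v) = (\<Sum>i\<le>k. t i (closed_segment v u) *\<^sub>R (u - v))"
    using e by (simp add: psi_edge flip: sum_subtractf)
  also have "\<dots> = u - v" using sum_t[OF e] by (simp flip: scaleR_sum_left)
  finally show "(\<Sum>i\<le>k. \<psi> i v) = v" using IH by simp
qed

lemma vertex_in_Q:
  assumes "i \<le> k" "w \<in> vertices P"
  shows "vertex_in N P w (Q i) = \<psi> i w"
  unfolding Q_eq by (rule vertex_in_summand[OF A psi_v0_potential(1) t_nonneg _ PN]) (use assms in auto)

text \<open>Integrality is prescribed only for differences of
  \<open>\<psi> i v - s i v *\<^sub>R v\<close> along edges. As this vector is 0 at
  \<open>v0\<close>, connectedness turns it into membership in \<open>N\<close> at each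
  vertex.\<close>

lemma T_int_iff:
  assumes "i \<le> k"
  shows "\<xi> i \<in> T_int N P \<longleftrightarrow> (\<forall>v\<in>vertices P. s i v \<in> \<int> \<and> \<psi> i v - s i v *\<^sub>R v \<in> N)"
proof -
  have step: "(t i (closed_segment v w) - s i v) *\<^sub>R v - (t i (closed_segment v w) - s i w) *\<^sub>R w
      = (\<psi> i v - s i v *\<^sub>R v) - (\<psi> i w - s i w *\<^sub>R w)"
    if "closed_segment v w \<in> compact_edges P" for v w
  proof -
    have "\<psi> i w = \<psi> i v + t i (closed_segment v w) *\<^sub>R (w - v)"
      using psi_edge[OF assms that] by (simp add: algebra_simps)
    then show ?thesis by (simp add: algebra_simps)
  qed
  have eq: "\<xi> i \<in> T_int N P \<longleftrightarrow> (\<forall>v\<in>vertices P. s i v \<in> \<int>) \<and>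
     (\<forall>v w. closed_segment v w \<in> compact_edges P \<longrightarrow>
        (\<psi> i v - s i v *\<^sub>R v) - (\<psi> i w - s i w *\<^sub>R w) \<in> N)"
    using mem_T[OF assms] step by (auto simp: T_int_def split: prod.splits)
  show ?thesis
  proof
    assume "\<xi> i \<in> T_int N P"
    note int = this[unfolded eq]
    have "\<psi> i v - s i v *\<^sub>R v \<in> N" if "v \<in> vertices P" for v
    proof (rule vertex_connected_induct[where R = "\<lambda>v. \<psi> i v - s i v *\<^sub>R v \<in> N", OF _ _ that])
      show "\<psi> i v0 - s i v0 *\<^sub>R v0 \<in> N"
        using psi_v0_potential(2)[OF assms] lattice_zero[OF lattice] by simp
      show "\<psi> i v - s i v *\<^sub>R v \<in> N"
        if "closed_segment v u \<in> compact_edges P" "\<psi> i u - s i u *\<^sub>R u \<in> N" for v u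
        using lattice_add[OF lattice _ that(2), of "(\<psi> i v - s i v *\<^sub>R v) - (\<psi> i u - s i u *\<^sub>R u)"]
          int that(1) by simp
    qed
    then show "\<forall>v\<in>vertices P. s i v \<in> \<int> \<and> \<psi> i v - s i v *\<^sub>R v \<in> N" using int by blast
  next
    assume "\<forall>v\<in>vertices P. s i v \<in> \<int> \<and> \<psi> i v - s i v *\<^sub>R v \<in> N"
    then show "\<xi> i \<in> T_int N P"
      unfolding eq using compact_edge_vertices lattice_diff[OF lattice] by blast
  qed
qed

text \<open>Condition (ii) with the vertex of the summand already evaluated; all implications pass
  through it.\<close>

definition detects :: bool where
  "detects \<longleftrightarrow> (\<forall>w\<in>vertices P. \<forall>i\<le>k. \<psi> i w \<notin> N \<longleftrightarrow> w \<notin> N \<and> s i w = 1)"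

lemma s_le_1:
  assumes "i \<le> k" "v \<in> vertices P"
  shows "s i v \<le> 1"
proof -
  have "s i v \<le> (\<Sum>j\<le>k. s j v)" using assms s_nonneg by (intro member_le_sum) auto
  then show ?thesis using sum_s[OF assms(2)] by (auto split: if_splits)
qed

text \<open>An integer between 0 and 1 is 0 or 1. For 0 the point \<open>\<psi> i w\<close> is in
  \<open>N\<close>; for 1 it is congruent to \<open>w\<close> modulo \<open>N\<close>.\<close>

lemma detects_if_T_int:
  assumes "\<And>i. i \<le> k \<Longrightarrow> \<xi> i \<in> T_int N P"
  shows detects
  unfolding detects_def
proof (intro ballI allI impI)
  fix w i assume w: "w \<in> vertices P" and i: "i \<le> k"
  have int: "s i w \<in> \<int>" and N: "\<psi> i w - s i w *\<^sub>R w \<in> N"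
    using assms[OF i] T_int_iff[OF i] w by auto
  obtain z :: int where z: "s i w = of_int z" using int by (auto elim: Ints_cases)
  then have "z = 0 \<or> z = 1" using s_nonneg[OF i w] s_le_1[OF i w] by auto
  then consider "s i w = 0" | "s i w = 1" using z by auto
  then show "\<psi> i w \<notin> N \<longleftrightarrow> w \<notin> N \<and> s i w = 1"
  proof cases
    case 2
    then have d: "\<psi> i w - w \<in> N" using N by simp
    have "\<psi> i w \<in> N \<longleftrightarrow> w \<in> N"
      using lattice_diff[OF lattice _ d, of "\<psi> i w"] lattice_add[OF lattice d, of w] by auto
    then show ?thesis using 2 by simp
  qed (use N in simp)
qed

section \<open>Consequences of condition (ii)\<close>

context
  assumes det: detects
begin

lemma psi_lattice_if_ne:
  assumes w: "w \<in> vertices P" and m: "m \<le> k" "\<psi> m w \<notin> N" and i: "i \<le> k" "i \<noteq> m"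
  shows "\<psi> i w \<in> N" "s i w = 0"
proof -
  have "s m w = 1" using det w m by (auto simp: detects_def)
  then show "s i w = 0" using s_unique w m i by blast
  then show "\<psi> i w \<in> N" using det w i(1) unfolding detects_def by (metis zero_neq_one)
qed

lemma detects_values:
  assumes w: "w \<in> vertices P" and i: "i \<le> k"
  shows "s i w = (if \<psi> i w \<in> N then 0 else 1)" "\<psi> i w - s i w *\<^sub>R w \<in> N"
proof -
  have "s i w = (if \<psi> i w \<in> N then 0 else 1) \<and> \<psi> i w - s i w *\<^sub>R w \<in> N"
  proof (cases "\<psi> i w \<in> N")
    case False
    then have 1: "s i w = 1" using det w i by (auto simp: detects_def)
    \<comment> \<open>All other summands are in \<open>N\<close> at \<open>w\<close>, so the
      exceptional one equals \<open>w\<close> modulo \<open>N\<close>.\<close>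
    have "w = \<psi> i w + (\<Sum>j\<in>{..k} - {i}. \<psi> j w)"
      using sum_psi[OF w] i by (simp add: sum.remove[of "{..k}" i])
    then have "\<psi> i w - w = - (\<Sum>j\<in>{..k} - {i}. \<psi> j w)" by (simp add: algebra_simps)
    also have "\<dots> \<in> N"
      using psi_lattice_if_ne(1)[OF w i False] by (intro lattice_uminus lattice_sum lattice) auto
    finally show ?thesis using False 1 by simp
  next
    case True
    have "s i w = 0"
    proof (cases "w \<in> N")
      case False
      \<comment> \<open>Points of \<open>N\<close> cannot add up to \<open>w\<close> outside
        \<open>N\<close>; the exceptional index takes the full weight 1 and leaves 0 for
        \<open>i\<close>.\<close>
      have "\<exists>m\<le>k. \<psi> m w \<notin> N"
        using False sum_psi[OF w] lattice_sum[OF lattice, of "{..k}" "\<lambda>i. \<psi> i w"] by auto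
      then show ?thesis using psi_lattice_if_ne(2)[OF w _ _ i] True by metis
    qed (use s_lattice w i in auto)
    then show ?thesis using True by simp
  qed
  then show "s i w = (if \<psi> i w \<in> N then 0 else 1)" "\<psi> i w - s i w *\<^sub>R w \<in> N" by auto
qed

lemma T_int_if_detects: "i \<le> k \<Longrightarrow> \<xi> i \<in> T_int N P"
  unfolding T_int_iff using detects_values by auto

text \<open>A functional in the dual of the tail has a minimising vertex \<open>w\<close>, and
  \<open>\<psi> i w\<close> lies in the minimal face of every summand at once; at most one of these
  points is outside \<open>N\<close>.\<close>

lemma lattice_friendly_if_detects: "lattice_friendly N P k Q"
  unfolding lattice_friendly_def minkowski_decomposition_def
proof (intro conjI allI impI ballI)
  show "polyhedron (Q i)" for i unfolding Q_eq by (rule polyhedron_summand[OF A])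
  show "(\<Sum>i\<le>k. Q i) = P"
    unfolding Q_eq by (rule sum_summands[OF A v0(1) psi_v0_potential(1) t_nonneg sum_psi])
  show "tail (Q i) = tail P" for i unfolding Q_eq tail_P by (rule tail_summand[OF A v0(1)])
  fix c assume "c \<in> tail_dual N P \<inter> dual_lattice N"
  then have c: "\<And>a. a \<in> hrec A \<Longrightarrow> 0 \<le> c \<bullet> a" by (auto simp: tail_dual_def tail_P inner_commute)
  obtain w where w: "w \<in> vertices P" "\<And>x. x \<in> P \<Longrightarrow> c \<bullet> w \<le> c \<bullet> x"
    using vertex_minimum[OF A vertex_pointed[OF A v0(1)] ne c] by blast
  obtain m where m: "m \<le> k" "\<And>i. i \<le> k \<Longrightarrow> i \<noteq> m \<Longrightarrow> \<psi> i w \<in> N"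
  proof (cases "\<exists>m\<le>k. \<psi> m w \<notin> N")
    case True
    then show thesis using that psi_lattice_if_ne(1)[OF w(1)] by blast
  next
    case False
    \<comment> \<open>With no exceptional summand at \<open>w\<close>, any index may be
      exempted.\<close>
    then show thesis using that[of 0] by blast
  qed
  have "\<psi> i w \<in> min_face (Q i) c" if "i \<le> k" for i
    unfolding Q_eq
    by (rule min_face_summand_vertex[OF A psi_v0_potential(1)[OF that] t_nonneg[OF that] w(1) c w(2)])
  then show "\<exists>m\<le>k. \<forall>i\<le>k. i \<noteq> m \<longrightarrow> min_face (Q i) c \<inter> N \<noteq> {}" using m by blast
qed

lemma kodaira_spencer_if_detects:
  assumes i: "i \<le> k"
  shows "kodaira_spencer N P (Q i) = \<xi> i"
proof -
  \<comment> \<open>Equality of parameters is equality of functions, so the values off the edges and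
    vertices must match too; both sides are 0 there.\<close>
  have par: "\<And>d. d \<notin> compact_edges P \<Longrightarrow> t i d = 0" "\<And>v. v \<notin> vertices P \<Longrightarrow> s i v = 0"
    using mem_T[OF i] by (auto simp: T_def params_def)
  have "t_coord N P (Q i) d = t i d" if d: "d \<in> compact_edges P" for d
    unfolding t_coord_def
  proof (rule the_equality)
    have diff: "vertex_in N P w (Q i) - vertex_in N P v (Q i) = t i d *\<^sub>R (w - v)"
      if "d = closed_segment v w" for v w
      using psi_edge[OF i, of v w] compact_edge_vertices[of v w P] d that vertex_in_Q[OF i] by simp
    then show "\<forall>v w. d = closed_segment v w \<longrightarrow>
        vertex_in N P w (Q i) - vertex_in N P v (Q i) = t i d *\<^sub>R (w - v)" by blast
    fix r assume r: "\<forall>v w. d = closed_segment v w \<longrightarrow>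
        vertex_in N P w (Q i) - vertex_in N P v (Q i) = r *\<^sub>R (w - v)"
    obtain v w where vw: "d = closed_segment v w" using compact_edge_obtain[OF d] .
    then have "r *\<^sub>R (w - v) = t i d *\<^sub>R (w - v)" using r diff by metis
    \<comment> \<open>Edges are nondegenerate, so \<open>w - v\<close> is nonzero and determines the
      scalar.\<close>
    then show "r = t i d" using compact_edge_vertices(3)[of v w P] d vw by simp
  qed
  then have "fst (kodaira_spencer N P (Q i)) = t i"
    using par(1) by (auto simp: kodaira_spencer_def)
  moreover have "snd (kodaira_spencer N P (Q i)) = s i"
  proof
    show "snd (kodaira_spencer N P (Q i)) v = s i v" for v
      by (cases "v \<in> vertices P")
        (use par(2) detects_values(1)[OF _ i] in \<open>auto simp: kodaira_spencer_def vertex_in_Q[OF i]\<close>)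
  qed
  ultimately show ?thesis by (rule prod_eqI)
qed

end

text \<open>The second coordinates say that \<open>s i\<close> is the indicator of
  \<open>\<psi> i w \<notin> N\<close>; the clause \<open>w \<notin> N\<close> follows because
  \<open>s i\<close> vanishes at vertices in \<open>N\<close>.\<close>

lemma detects_if_kodaira_spencer:
  assumes "\<And>i. i \<le> k \<Longrightarrow> kodaira_spencer N P (Q i) = \<xi> i"
  shows detects
  unfolding detects_def
proof (intro ballI allI impI)
  fix w i assume w: "w \<in> vertices P" and i: "i \<le> k"
  have "s i w = (if \<psi> i w \<notin> N then 1 else 0)"
    using arg_cong[OF assms[OF i], of "\<lambda>x. snd x w"] w vertex_in_Q[OF i w]
    by (simp add: kodaira_spencer_def)
  then show "\<psi> i w \<notin> N \<longleftrightarrow> w \<notin> N \<and> s i w = 1"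
    using s_lattice[OF i w] by (auto split: if_splits)
qed

lemma equivalences:
  "((\<forall>i\<le>k. \<xi> i \<in> T_int N P) \<longleftrightarrow>
     (\<forall>w\<in>vertices P. \<forall>i\<le>k. vertex_in N P w (Q i) \<notin> N \<longleftrightarrow> w \<notin> N \<and> s i w = 1)) \<and>
   ((\<forall>i\<le>k. \<xi> i \<in> T_int N P) \<longleftrightarrow>
     lattice_friendly N P k Q \<and> (\<forall>i\<le>k. kodaira_spencer N P (Q i) = \<xi> i))"
proof -
  have "detects \<longleftrightarrow> (\<forall>w\<in>vertices P. \<forall>i\<le>k. vertex_in N P w (Q i) \<notin> N \<longleftrightarrow> w \<notin> N \<and> s i w = 1)"
    by (simp add: detects_def vertex_in_Q)
  moreover have "(\<forall>i\<le>k. \<xi> i \<in> T_int N P) \<longleftrightarrow> detects"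
    using detects_if_T_int T_int_if_detects by blast
  moreover have "lattice_friendly N P k Q \<and> (\<forall>i\<le>k. kodaira_spencer N P (Q i) = \<xi> i) \<longleftrightarrow> detects"
    using lattice_friendly_if_detects kodaira_spencer_if_detects detects_if_kodaira_spencer by blast
  ultimately show ?thesis by blast
qed

end

theorem theorem9p12:
  fixes N P :: "'a::euclidean_space set" and v0 :: 'a
    and k :: nat and \<xi> :: "nat \<Rightarrow> 'a param"
  assumes "is_lattice N"
    and "rational_polyhedron N P"
    and "v0 \<in> vertices P"
    and "v0 \<notin> N \<or> v0 = 0"
    and "\<forall>i\<le>k. \<xi> i \<in> T_plus N P"
    and "(\<Sum>i\<le>k. \<xi> i) = one_param N P"
  shows "((\<forall>i\<le>k. \<xi> i \<in> T_int N P) \<longleftrightarrow>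
          (\<forall>w\<in>vertices P. \<forall>i\<le>k.
             vertex_in N P w (P_param P v0 (\<xi> i)) \<notin> N \<longleftrightarrow> w \<notin> N \<and> snd (\<xi> i) w = 1)) \<and>
         ((\<forall>i\<le>k. \<xi> i \<in> T_int N P) \<longleftrightarrow>
          lattice_friendly N P k (\<lambda>i. P_param P v0 (\<xi> i)) \<and>
          (\<forall>i\<le>k. kodaira_spencer N P (P_param P v0 (\<xi> i)) = \<xi> i))"
proof -
  \<comment> \<open>The system \<open>A\<close> describes \<open>P\<close> in the whole type, so the
    equations of \<open>span N\<close> are absorbed into its inequalities.\<close>
  obtain A where fin: "finite A" and P: "P = hpoly A"
    using polyhedron_imp_hpoly polyhedron_rational_polyhedron(1)[OF assms(2)] by metis
  interpret minkowski_parameters N A v0 k \<xi>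
    using assms fin P polyhedron_rational_polyhedron(2)[OF assms(2)] by unfold_locales auto
  show ?thesis unfolding P by (rule equivalences)
qed

end
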